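(* For each team $t\in V$ and each slot $k\in\{1,2,\dots,n-1\}$, each of the following four inequalities is facet-defining for $P_{\mathrm{utt}}(n)$: $$\sum_{j\in V\setminus\{t\}}y_{t,t,j}+\sum_{j\in V\setminus\{t\}}(x_{k,t,j}+x_{k+n-1,t,j})\ge 2,\qquad \sum_{j\in V\setminus\{t\}}y_{t,t,j}+\sum_{j\in V\setminus\{t\}}(x_{k,j,t}+x_{k+n-1,j,t})\ge 2,$$ $$\sum_{i\in V\setminus\{t\}}y_{t,i,t}+\sum_{i\in V\setminus\{t\}}(x_{k,t,i}+x_{k+n-1,t,i})\ge 2,\qquad \sum_{i\in V\setminus\{t\}}y_{t,i,t}+\sum_{i\in V\setminus\{t\}}(x_{k,i,t}+x_{k+n-1,i,t})\ge 2.$$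
   Context: Let $n\ge4$ be even, $V=\{1,\dots,n\}$ (teams; team $i$ has home venue $i$), $S=\{1,\dots,2n-2\}$ (slots), $A=\{(i,j)\in V\times V:i\ne j\}$, $\mathcal M=\{(k,i,j):k\in S,(i,j)\in A\}$, where $(k,i,j)$ denotes the match between $i$ and $j$ at venue $i$ in slot $k$. Coordinates are $x_{k,i,j}$ ($(k,i,j)\in\mathcal M$) and $y_{t,i,j}$ ($t\in V$, $(i,j)\in A$). A tournament is a set $T\subseteq\mathcal M$ whose incidence vector $x=\chi(T)\in\{0,1\}^{\mathcal M}$ satisfies $\sum_{j\in V\setminus\{i\}}(x_{k,i,j}+x_{k,j,i})=1$ for all $k\in S$, $k\ge2$, $i\in V$, and $\sum_{k\in S}x_{k,i,j}=1$ for all $(i,j)\in A$. In $T$, team $t$ is at venue $t$ in a slot where it plays at home and at venue $i$ in slot $k$ if $(k,i,t)\in T$; before slot 1 and after slot $2n-2$ it is at venue $t$. Team $t$ travels from venue $i$ to venue $j\ne i$ if it is at $i$ and then at $j$ at consecutive positions of (start, slot $1$, …, slot $2n-2$, end). The travel vector $\psi(T)\in\{0,1\}^{V\times A}$ has $\psi(T)_{t,i,j}=1$ iff team $t$ travels from $i$ to $j$. $P_{\mathrm{utt}}(n)=\mathrm{conv}\{(\chi(T),y)\in\{0,1\}^{\mathcal M}\times\{0,1\}^{V\times A}: T\text{ tournament},\ y\ge\psi(T)\}$. An inequality is facet-defining if it is valid and the face it induces is a facet. *)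

theory Defs
  imports "HOL-Analysis.Analysis" "HOL-Library.Cardinality"
begin

(* The set V of teams is the whole type 'v, so n = CARD('v).  The sort card2 (finite with at
   least two elements) guarantees that the index sets below are nonempty, so that they can be
   turned into types. *)

definition slots :: "'v::card2 itself \<Rightarrow> nat set" where
  "slots _ = {1..2 * CARD('v) - 2}"

definition arcs :: "('v::card2 \<times> 'v) set" where
  "arcs = {(i, j). i \<noteq> j}"

(* (k, i, j): teams i and j play at venue i in slot k *)
definition matches :: "(nat \<times> 'v::card2 \<times> 'v) set" where
  "matches = slots TYPE('v) \<times> arcs"

definition team_arcs :: "('v::card2 \<times> 'v \<times> 'v) set" where
  "team_arcs = UNIV \<times> arcs"

lemma arcs_nonempty: "(arcs :: ('v::card2 \<times> 'v) set) \<noteq> {}"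
proof
  assume "(arcs :: ('v \<times> 'v) set) = {}"
  then have "x = y" for x y :: 'v
    by (auto simp: arcs_def)
  then have "(UNIV :: 'v set) = {undefined}"
    by auto
  then have "CARD('v) = 1"
    by (metis card_1_singleton_iff One_nat_def)
  then show False
    using one_less_card[where 'a = 'v] by simp
qed

lemma slots_nonempty: "slots TYPE('v::card2) \<noteq> {}"
  using one_less_card[where 'a = 'v] by (auto simp: slots_def)

typedef ('v::card2) match_idx = "matches :: (nat \<times> 'v \<times> 'v) set"
  using arcs_nonempty slots_nonempty[where 'v = 'v] unfolding matches_def by blast

typedef ('v::card2) travel_idx = "team_arcs :: ('v \<times> 'v \<times> 'v) set"
  using arcs_nonempty unfolding team_arcs_def by blast

instance match_idx :: (card2) finite
proof
  have "finite (matches :: (nat \<times> 'a \<times> 'a) set)"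
    by (simp add: matches_def slots_def)
  then show "finite (UNIV :: 'a match_idx set)"
    unfolding type_definition.univ[OF type_definition_match_idx] by simp
qed

instance travel_idx :: (card2) finite
proof
  show "finite (UNIV :: 'a travel_idx set)"
    unfolding type_definition.univ[OF type_definition_travel_idx] by simp
qed

type_synonym 'v point = "(real ^ 'v match_idx) \<times> (real ^ 'v travel_idx)"

(* Meaningful only for (k, i, j) in matches and (t, i, j) in team_arcs, respectively. *)

definition xc :: "'v::card2 point \<Rightarrow> nat \<Rightarrow> 'v \<Rightarrow> 'v \<Rightarrow> real" where
  "xc p k i j = fst p $ Abs_match_idx (k, i, j)"

definition yc :: "'v::card2 point \<Rightarrow> 'v \<Rightarrow> 'v \<Rightarrow> 'v \<Rightarrow> real" where
  "yc p t i j = snd p $ Abs_travel_idx (t, i, j)"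

(* Slot 1 is deliberately absent from the first family of equations: there the equation follows
   from the others. *)
definition tournament :: "(nat \<times> 'v::card2 \<times> 'v) set \<Rightarrow> bool" where
  "tournament T \<longleftrightarrow>
     T \<subseteq> matches \<and>
     (\<forall>k\<in>slots TYPE('v). k \<ge> 2 \<longrightarrow>
        (\<forall>i. (\<Sum>j\<in>UNIV - {i}. indicat_real T (k, i, j) + indicat_real T (k, j, i)) = 1)) \<and>
     (\<forall>(i, j)\<in>arcs. (\<Sum>k\<in>slots TYPE('v). indicat_real T (k, i, j)) = 1)"

definition chi :: "(nat \<times> 'v::card2 \<times> 'v) set \<Rightarrow> real ^ 'v match_idx" where
  "chi T = (\<chi> m. indicat_real T (Rep_match_idx m))"

(* Position 0 is the start and position 2n - 1 the end. *)
definition at_venue :: "(nat \<times> 'v::card2 \<times> 'v) set \<Rightarrow> 'v \<Rightarrow> nat \<Rightarrow> 'v \<Rightarrow> bool" where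
  "at_venue T t p v \<longleftrightarrow>
     p \<in> {0, 2 * CARD('v) - 1} \<and> v = t \<or>
     p \<in> slots TYPE('v) \<and> ((\<exists>j. (p, t, j) \<in> T) \<and> v = t \<or> (p, v, t) \<in> T)"

definition travels :: "(nat \<times> 'v::card2 \<times> 'v) set \<Rightarrow> 'v \<Rightarrow> 'v \<Rightarrow> 'v \<Rightarrow> bool" where
  "travels T t i j \<longleftrightarrow>
     i \<noteq> j \<and> (\<exists>p \<le> 2 * CARD('v) - 2. at_venue T t p i \<and> at_venue T t (Suc p) j)"

definition psi :: "(nat \<times> 'v::card2 \<times> 'v) set \<Rightarrow> real ^ 'v travel_idx" where
  "psi T = (\<chi> q. case Rep_travel_idx q of (t, i, j) \<Rightarrow> of_bool (travels T t i j))"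

definition P_utt :: "'v::card2 point set" where
  "P_utt = convex hull {(chi T, y) | T y. tournament T \<and> (\<forall>q. y $ q \<in> {0, 1}) \<and> psi T \<le> y}"

(* The inequality f p \<ge> b *)
definition facet_defining :: "('a::euclidean_space \<Rightarrow> real) \<Rightarrow> real \<Rightarrow> 'a set \<Rightarrow> bool" where
  "facet_defining f b P \<longleftrightarrow> linear f \<and> (\<forall>p\<in>P. f p \<ge> b) \<and> {p\<in>P. f p = b} facet_of P"

end

theory Submission
  imports Defs
begin

text \<open>A face is a facet as soon as every linear functional that is constant on its vertices is, up to
  a constant, a multiple of the inequality on all vertices. If team \<open>t\<close> leaves home only once, its
  away slots form a block of \<open>n - 1\<close> consecutive slots, which contains exactly one of \<open>k\<close> and
  \<open>k + n - 1\<close>; this gives validity. Tournaments with an almost arbitrary set of away slots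
  of \<open>t\<close> and order of opponents are assembled from two 1-factorizations of the complete graph.
  Given a functional constant on the face, reversing the venues of a match of two teams other than \<open>t\<close>,
  and exchanging two slots along a 4-cycle avoiding \<open>t\<close>, shows that its coefficients
  for such matches are combinations of the tournament equations. After subtracting these, only the
  sequence of opponents of \<open>t\<close> matters: permuting it splits each remaining coefficient into a slot part
  and an opponent part, shifting a block makes the difference of the slot parts of away and home matches
  periodic with period \<open>n - 1\<close>, and away sets consisting of two blocks determine it.\<close>

section \<open>A criterion for facets\<close>

text \<open>The dimension of the polytope is never computed; the work lies in having enough
  tournaments on the face. Home-away patterns of a whole tournament are hard to control, but
  equality depends only on the away set and the trips of \<open>t\<close>. So rounds are named by
  the opponent of \<open>t\<close>: whatever the \<open>n - 1\<close> away slots are, each opponent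
  is met once inside and once outside them, each round is played twice, and the second time all
  venues can be reversed. The venues of the other teams are left to an arbitrary orientation, which
  then serves as a source of exchanges. With a single factorization, the two slots sharing an
  opponent of \<open>t\<close> would carry the same matching and only venues could vary; the second
  factorization makes a 4-cycle possible. A travel coordinate outside the inequality can always be
  1; its coefficient vanishes because some tournament on the face does not make that trip, so it can
  also be 0. Such tournaments open with two away matches of one team. For \<open>n = 4\<close> there
  is no 4-cycle avoiding \<open>t\<close>, and none is needed: any three values on the edges of a
  triangle are sums of vertex potentials.\<close>

lemma facet_criterion:
  fixes f :: "'a::euclidean_space \<Rightarrow> real"
  assumes lin: "linear f"
    and valid: "\<And>p. p \<in> X \<Longrightarrow> b \<le> f p"
    and p0: "p0 \<in> X" "f p0 = b"
    and q: "q \<in> X" "b < f q"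
    and key: "\<And>g. linear g \<Longrightarrow> (\<And>p. p \<in> X \<Longrightarrow> f p = b \<Longrightarrow> g p = g p0) \<Longrightarrow>
                \<exists>l. \<forall>p\<in>X. g p = g p0 + l * (f p - b)"
  shows "facet_defining f b (convex hull X)"
proof -
  let ?P = "convex hull X" and ?F = "{p \<in> convex hull X. f p = b}"
  obtain z where z: "f x = z \<bullet> x" for x
  proof
    fix x show "f x = adjoint f 1 \<bullet> x"
      using adjoint_works[OF lin, of x 1] by (simp add: inner_commute)
  qed
  have "?P \<subseteq> {x. z \<bullet> x \<ge> b}"
    by (rule hull_minimal) (use valid z in \<open>auto simp: convex_halfspace_ge\<close>)
  then have validP: "b \<le> f p" if "p \<in> ?P" for p
    using that z by auto
  have "?P \<inter> {x. z \<bullet> x = b} face_of ?P"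
    by (rule face_of_Int_supporting_hyperplane_ge) (use validP z in auto)
  moreover have "?P \<inter> {x. z \<bullet> x = b} = ?F"
    using z by auto
  ultimately have face: "?F face_of ?P"
    by simp
  have p0F: "p0 \<in> ?F"
    using p0 by (simp add: hull_inc)
  have qP: "q \<in> ?P"
    using q by (simp add: hull_inc)
  have "?F \<noteq> ?P"
    using qP q(2) by force
  then have less: "aff_dim ?F < aff_dim ?P"
    using face face_of_aff_dim_lt[OF convex_convex_hull] by blast
  \<comment> \<open>A point outside this hull would have a component \<open>w\<close> orthogonal to
    its direction space. The functional given by \<open>w\<close> is constant on the face and has
    the same value at \<open>q\<close>; by \<open>key\<close> it is a multiple of
    \<open>f - b\<close> up to a constant, and \<open>b < f q\<close> makes the multiple
    zero.\<close>
  have "X \<subseteq> affine hull (insert q ?F)"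
  proof
    fix p assume p: "p \<in> X"
    let ?W = "(\<lambda>x. x - p0) ` insert q ?F"
    obtain y w where y: "y \<in> span ?W" and w: "\<And>v. v \<in> span ?W \<Longrightarrow> orthogonal w v"
      and sum: "p - p0 = y + w"
      by (rule orthogonal_subspace_decomp_exists) auto
    have const: "w \<bullet> x = w \<bullet> p0" if "x \<in> insert q ?F" for x
      using w[OF span_base, of "x - p0"] that by (auto simp: orthogonal_def inner_diff_right)
    have "linear (\<lambda>x. w \<bullet> x)"
      by (simp add: bounded_linear.linear bounded_linear_inner_right)
    then obtain l where l: "\<And>x. x \<in> X \<Longrightarrow> w \<bullet> x = w \<bullet> p0 + l * (f x - b)"
      using key[of "\<lambda>x. w \<bullet> x"] const hull_inc[of _ X] by blast
    have "l = 0"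
      using l[OF q(1)] const[of q] q(2) by simp
    then have "w \<bullet> (p - p0) = 0"
      using l[OF p] by (simp add: inner_diff_right)
    moreover have "w \<bullet> y = 0"
      using w[OF y] by (simp add: orthogonal_def)
    ultimately have "w = 0"
      by (simp add: sum inner_add_right)
    then have "p = p0 + y"
      using sum by (simp add: algebra_simps)
    then show "p \<in> affine hull (insert q ?F)"
      using y p0F by (auto simp: affine_hull_span_gen[OF hull_inc[of p0]] image_iff)
  qed
  then have "?P \<subseteq> affine hull (insert q ?F)"
    by (simp add: hull_minimal affine_imp_convex)
  then have "aff_dim ?P \<le> aff_dim (insert q ?F)"
    by (metis aff_dim_affine_hull aff_dim_subset)
  then have "aff_dim ?P \<le> aff_dim ?F + 1"
    by (simp add: aff_dim_insert split: if_splits)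
  with less have "aff_dim ?F = aff_dim ?P - 1"
    by simp
  then show ?thesis
    using face p0F lin validP unfolding facet_defining_def facet_of_def by blast
qed

section \<open>Tournaments\<close>

definition away :: "(nat \<times> 'v \<times> 'v) set \<Rightarrow> 'v \<Rightarrow> nat set" where
  "away T s = {k. \<exists>i. (k, i, s) \<in> T}"

text \<open>Positions \<open>0\<close> and \<open>2 * N + 1\<close> are the start and the end, where every team is at home;
  as they are never in \<^term>\<open>A\<close>, the first and the last away block need no special treatment.\<close>

definition turns :: "bool \<Rightarrow> nat set \<Rightarrow> nat set" where
  "turns out A = {k \<in> A. (if out then k - 1 else Suc k) \<notin> A}"

text \<open>\<open>N\<close> stands for \<open>n - 1\<close>, so that the two slots in the
  inequality lie at distance \<open>N\<close> and the circle method can work modulo an odd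
  number.\<close>

locale teams =
  fixes t :: "'v::card2" and N :: nat
  assumes card_teams: "CARD('v) = Suc N" and N_ge: "3 \<le> N" and odd_N: "odd N"
begin

lemma slots: "slots TYPE('v) = {1..2 * N}"
  by (simp add: slots_def card_teams)

lemma mem_matches: "(k, i, j) \<in> (matches :: (nat \<times> 'v \<times> 'v) set) \<longleftrightarrow> k \<in> {1..2 * N} \<and> i \<noteq> j"
  by (auto simp: matches_def arcs_def slots)

context
  fixes T :: "(nat \<times> 'v \<times> 'v) set"
  assumes T: "tournament T"
begin

lemma tournamentD: "(k, i, j) \<in> T \<Longrightarrow> k \<in> {1..2 * N} \<and> i \<noteq> j"
  using T mem_matches unfolding tournament_def by blast

lemma finite_tournament: "finite T"
proof -
  have "finite (matches :: (nat \<times> 'v \<times> 'v) set)"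
    by (simp add: matches_def slots)
  then show ?thesis
    using T finite_subset unfolding tournament_def by blast
qed

lemma unique_slot:
  assumes "i \<noteq> j"
  shows "\<exists>!k. (k, i, j) \<in> T"
proof -
  have "(\<Sum>k\<in>{1..2 * N}. indicat_real T (k, i, j)) = 1"
    using T assms unfolding tournament_def slots arcs_def by auto
  then have "real (card {k \<in> {1..2 * N}. (k, i, j) \<in> T}) = 1"
    by (simp add: indicator_def of_bool_def[symmetric] sum.If_cases Int_def)
  moreover have "{k \<in> {1..2 * N}. (k, i, j) \<in> T} = {k. (k, i, j) \<in> T}"
    using tournamentD by auto
  ultimately have "card {k. (k, i, j) \<in> T} = 1"
    by simp
  then obtain k where "{k. (k, i, j) \<in> T} = {k}"
    by (rule card_1_singletonE)
  then have "\<And>l. (l, i, j) \<in> T \<longleftrightarrow> l = k"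
    by (simp add: set_eq_iff)
  then show ?thesis
    by simp
qed

lemma slot_sum_card:
  "(\<Sum>j\<in>UNIV - {i}. indicat_real T (k, i, j)) = card {j. (k, i, j) \<in> T}"
  "(\<Sum>j\<in>UNIV - {i}. indicat_real T (k, j, i)) = card {j. (k, j, i) \<in> T}"
proof -
  have "(UNIV - {i}) \<inter> {j. (k, i, j) \<in> T} = {j. (k, i, j) \<in> T}"
    "(UNIV - {i}) \<inter> {j. (k, j, i) \<in> T} = {j. (k, j, i) \<in> T}"
    using tournamentD by auto
  then show "(\<Sum>j\<in>UNIV - {i}. indicat_real T (k, i, j)) = card {j. (k, i, j) \<in> T}"
    "(\<Sum>j\<in>UNIV - {i}. indicat_real T (k, j, i)) = card {j. (k, j, i) \<in> T}"
    by (simp_all add: indicator_def of_bool_def[symmetric] sum.If_cases)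
qed

text \<open>For slot 1 this is recovered by counting: over all slots a team meets each opponent at
  both venues, \<open>2 * N\<close> matches in total, and the later slots account for
  \<open>2 * N - 1\<close> of them.\<close>

lemma one_match_per_slot:
  assumes k: "k \<in> {1..2 * N}"
  shows "card {j. (k, i, j) \<in> T} + card {j. (k, j, i) \<in> T} = 1"
proof -
  define c where "c k = (\<Sum>j\<in>UNIV - {i}. indicat_real T (k, i, j) + indicat_real T (k, j, i))" for k
  have c: "c k = 1" if "2 \<le> k" "k \<in> {1..2 * N}" for k
    using T that unfolding tournament_def slots c_def by auto
  have "(\<Sum>k\<in>{1..2 * N}. indicat_real T (k, i, j)) = 1"
       "(\<Sum>k\<in>{1..2 * N}. indicat_real T (k, j, i)) = 1" if "j \<noteq> i" for j
    using T that unfolding tournament_def slots arcs_def by auto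
  then have "(\<Sum>k\<in>{1..2 * N}. c k) = (\<Sum>j\<in>UNIV - {i}. 2)"
    unfolding c_def by (subst sum.swap) (auto intro!: sum.cong simp: sum.distrib)
  also have "\<dots> = 2 * N"
    by (simp add: card_Diff_singleton card_teams)
  finally have "(\<Sum>k\<in>{1..2 * N}. c k) = 2 * N" .
  moreover have "{1..2 * N} = insert 1 {2..2 * N}"
    using N_ge by auto
  ultimately have "c 1 + (\<Sum>k\<in>{2..2 * N}. c k) = 2 * N"
    by simp
  moreover have "(\<Sum>k\<in>{2..2 * N}. c k) = (\<Sum>k\<in>{2..2 * N}. 1)"
    by (rule sum.cong) (use c in auto)
  ultimately have "c 1 = 1"
    using N_ge by (simp add: of_nat_diff)
  then have "c k = 1"
    using c k by (cases "k = 1") auto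
  then have "real (card {j. (k, i, j) \<in> T} + card {j. (k, j, i) \<in> T}) = 1"
    unfolding c_def by (simp add: sum.distrib slot_sum_card)
  then show ?thesis
    by linarith
qed

lemma sum_home: "k \<in> {1..2 * N} \<Longrightarrow> (\<Sum>j\<in>UNIV - {s}. indicat_real T (k, s, j)) = of_bool (k \<notin> away T s)"
  and sum_away: "k \<in> {1..2 * N} \<Longrightarrow> (\<Sum>j\<in>UNIV - {s}. indicat_real T (k, j, s)) = of_bool (k \<in> away T s)"
  and home_iff: "k \<in> {1..2 * N} \<Longrightarrow> (\<exists>j. (k, s, j) \<in> T) \<longleftrightarrow> k \<notin> away T s"
  and away_unique: "(k, i, s) \<in> T \<Longrightarrow> (k, j, s) \<in> T \<Longrightarrow> i = j"
proof -
  let ?H = "{j. (k, s, j) \<in> T}" and ?A = "{j. (k, j, s) \<in> T}"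
  have cases: "card ?A = 1 \<and> ?H = {} \<or> card ?H = 1 \<and> ?A = {}" if "k \<in> {1..2 * N}"
  proof -
    have "card ?H = 0 \<or> card ?A = 0" "card ?H + card ?A = 1"
      using one_match_per_slot[OF that, of s] by linarith+
    then show ?thesis by auto
  qed
  { assume k: "k \<in> {1..2 * N}"
    show "(\<Sum>j\<in>UNIV - {s}. indicat_real T (k, s, j)) = of_bool (k \<notin> away T s)"
      using cases[OF k] by (auto simp: slot_sum_card away_def card_1_singleton_iff)
    show "(\<Sum>j\<in>UNIV - {s}. indicat_real T (k, j, s)) = of_bool (k \<in> away T s)"
      using cases[OF k] by (auto simp: slot_sum_card away_def card_1_singleton_iff)
    show "(\<exists>j. (k, s, j) \<in> T) \<longleftrightarrow> k \<notin> away T s"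
      using cases[OF k] by (auto simp: away_def card_1_singleton_iff) }
  assume m: "(k, i, s) \<in> T" "(k, j, s) \<in> T"
  then have "card ?A = 1"
    using cases tournamentD[OF m(1)] by blast
  then obtain l where "?A = {l}"
    by (rule card_1_singletonE)
  then have "\<And>i. (k, i, s) \<in> T \<longleftrightarrow> i = l"
    by (simp add: set_eq_iff)
  with m show "i = j"
    by simp
qed

lemma away_subset: "away T s \<subseteq> {1..2 * N}"
  using tournamentD by (auto simp: away_def)

text \<open>Away slots and hosts correspond one to one: one opponent per slot, one visit per
  venue.\<close>

lemma card_opponents:
  assumes "K \<subseteq> away T s"
  shows "card {j. \<exists>k\<in>K. (k, j, s) \<in> T} = card K"
proof -
  let ?R = "{(k, j). k \<in> K \<and> (k, j, s) \<in> T}"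
  have "inj_on fst ?R"
    by (rule inj_onI, clarsimp) (metis away_unique)
  then have "card (fst ` ?R) = card ?R"
    by (rule card_image)
  moreover have "inj_on snd ?R"
    by (rule inj_onI, clarsimp) (metis tournamentD unique_slot)
  then have "card (snd ` ?R) = card ?R"
    by (rule card_image)
  moreover have "fst ` ?R = K"
    using assms by (force simp: away_def image_iff)
  moreover have "snd ` ?R = {j. \<exists>k\<in>K. (k, j, s) \<in> T}"
    by (force simp: image_iff)
  ultimately show ?thesis
    by simp
qed

lemma card_away: "card (away T s) = N"
proof -
  have "{j. \<exists>k\<in>away T s. (k, j, s) \<in> T} = UNIV - {s}"
  proof (intro set_eqI iffI)
    fix j assume "j \<in> UNIV - {s}"
    then obtain k where "(k, j, s) \<in> T"
      using unique_slot[of j s] by auto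
    then show "j \<in> {j. \<exists>k\<in>away T s. (k, j, s) \<in> T}"
      by (auto simp: away_def)
  qed (use tournamentD in blast)
  then show ?thesis
    using card_opponents[of "away T s" s] by (simp add: card_Diff_singleton card_teams)
qed

section \<open>Trips of a team read off from its away set\<close>

lemma at_venue_own: "p \<le> Suc (2 * N) \<Longrightarrow> at_venue T s p s \<longleftrightarrow> p \<notin> away T s"
  using home_iff[of p s] tournamentD[of p s s] away_subset[of s]
  by (auto simp: at_venue_def slots card_teams)

lemma at_venue_other: "j \<noteq> s \<Longrightarrow> at_venue T s p j \<longleftrightarrow> (p, j, s) \<in> T"
  using tournamentD[of p j s] by (auto simp: at_venue_def slots)

lemma travels_leg:
  assumes "j \<noteq> s"
  shows "(if out then travels T s s j else travels T s j s) \<longleftrightarrow> (\<exists>k\<in>turns out (away T s). (k, j, s) \<in> T)"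
proof (cases out)
  case True
  have "travels T s s j \<longleftrightarrow> (\<exists>p\<le>2 * N. p \<notin> away T s \<and> (Suc p, j, s) \<in> T)"
    using assms by (auto simp: travels_def at_venue_own at_venue_other card_teams)
  also have "\<dots> \<longleftrightarrow> (\<exists>k\<in>turns True (away T s). (k, j, s) \<in> T)"
  proof
    assume "\<exists>p\<le>2 * N. p \<notin> away T s \<and> (Suc p, j, s) \<in> T"
    then show "\<exists>k\<in>turns True (away T s). (k, j, s) \<in> T"
      by (force simp: turns_def away_def)
  next
    assume "\<exists>k\<in>turns True (away T s). (k, j, s) \<in> T"
    then obtain k where "(k, j, s) \<in> T" "k - 1 \<notin> away T s"
      by (auto simp: turns_def)
    then show "\<exists>p\<le>2 * N. p \<notin> away T s \<and> (Suc p, j, s) \<in> T"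
      using tournamentD[of k j s] by (intro exI[of _ "k - 1"]) auto
  qed
  finally show ?thesis using True by simp
next
  case False
  have "travels T s j s \<longleftrightarrow> (\<exists>p\<le>2 * N. (p, j, s) \<in> T \<and> Suc p \<notin> away T s)"
    using assms by (auto simp: travels_def at_venue_own at_venue_other card_teams)
  also have "\<dots> \<longleftrightarrow> (\<exists>k\<in>turns False (away T s). (k, j, s) \<in> T)"
    using tournamentD by (fastforce simp: turns_def away_def)
  finally show ?thesis using False by simp
qed

text \<open>Each venue is visited only once, so distinct turns belong to distinct trips and nothing
  is merged in the 0/1 count.\<close>

lemma sum_legs:
  "(\<Sum>j\<in>UNIV - {s}. of_bool (if out then travels T s s j else travels T s j s)) = real (card (turns out (away T s)))"
proof -
  have "(\<Sum>j\<in>UNIV - {s}. of_bool (if out then travels T s s j else travels T s j s)) =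
     (\<Sum>j\<in>UNIV - {s}. of_bool (\<exists>k\<in>turns out (away T s). (k, j, s) \<in> T) :: real)"
    by (rule sum.cong) (use travels_leg in auto)
  also have "\<dots> = card {j. \<exists>k\<in>turns out (away T s). (k, j, s) \<in> T}"
  proof -
    have "(UNIV - {s}) \<inter> {j. \<exists>k\<in>turns out (away T s). (k, j, s) \<in> T} = {j. \<exists>k\<in>turns out (away T s). (k, j, s) \<in> T}"
      using tournamentD by auto
    then show ?thesis by (simp add: of_bool_def sum.If_cases)
  qed
  also have "card {j. \<exists>k\<in>turns out (away T s). (k, j, s) \<in> T} = card (turns out (away T s))"
    by (rule card_opponents) (auto simp: turns_def)
  finally show ?thesis .
qed

text \<open>These functionals are the combinations of the tournament equations, with weights
  \<open>u\<close> on the slot equations (slot 1 included) and \<open>w\<close> on the ordered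
  pairs. They can be subtracted from any functional without affecting constancy.\<close>

lemma sum_tournament:
  fixes u :: "nat \<Rightarrow> 'v \<Rightarrow> real" and w :: "'v \<Rightarrow> 'v \<Rightarrow> real"
  shows "(\<Sum>(k, i, j)\<in>T. u k i + u k j + w i j) = (\<Sum>k\<in>{1..2 * N}. \<Sum>i\<in>UNIV. u k i) + (\<Sum>(i, j)\<in>arcs. w i j)"
proof -
  let ?S = "{1..2 * N}"
  have 1: "(\<Sum>(k, i, j)\<in>T. u k i) = (\<Sum>k\<in>?S. \<Sum>i\<in>UNIV. card {j. (k, i, j) \<in> T} * u k i)"
  proof -
    have "T = (SIGMA k:?S. SIGMA i:UNIV. {j. (k, i, j) \<in> T})"
      using tournamentD by auto
    then have "(\<Sum>(k, i, j)\<in>T. u k i) = (\<Sum>(k, i, j)\<in>(SIGMA k:?S. SIGMA i:UNIV. {j. (k, i, j) \<in> T}). u k i)"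
      by simp
    also have "\<dots> = (\<Sum>k\<in>?S. \<Sum>(i, j)\<in>(SIGMA i:UNIV. {j. (k, i, j) \<in> T}). u k i)"
      by (subst sum.Sigma[symmetric]) auto
    also have "\<dots> = (\<Sum>k\<in>?S. \<Sum>i\<in>UNIV. \<Sum>j\<in>{j. (k, i, j) \<in> T}. u k i)"
      by (intro sum.cong refl, subst sum.Sigma[symmetric]) auto
    finally show ?thesis by simp
  qed
  have 2: "(\<Sum>(k, i, j)\<in>T. u k j) = (\<Sum>k\<in>?S. \<Sum>i\<in>UNIV. card {j. (k, j, i) \<in> T} * u k i)"
  proof -
    have "(\<Sum>(k, i, j)\<in>T. u k j) = (\<Sum>(k, i, j)\<in>(SIGMA k:?S. SIGMA i:UNIV. {j. (k, j, i) \<in> T}). u k i)"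
      by (rule sum.reindex_bij_witness[of _ "\<lambda>(k, i, j). (k, j, i)" "\<lambda>(k, i, j). (k, j, i)"])
        (use tournamentD in auto)
    also have "\<dots> = (\<Sum>k\<in>?S. \<Sum>(i, j)\<in>(SIGMA i:UNIV. {j. (k, j, i) \<in> T}). u k i)"
      by (subst sum.Sigma[symmetric]) auto
    also have "\<dots> = (\<Sum>k\<in>?S. \<Sum>i\<in>UNIV. \<Sum>j\<in>{j. (k, j, i) \<in> T}. u k i)"
      by (intro sum.cong refl, subst sum.Sigma[symmetric]) auto
    finally show ?thesis by simp
  qed
  have "(\<Sum>(k, i, j)\<in>T. u k i) + (\<Sum>(k, i, j)\<in>T. u k j) =
     (\<Sum>k\<in>?S. \<Sum>i\<in>UNIV. real (card {j. (k, i, j) \<in> T} + card {j. (k, j, i) \<in> T}) * u k i)"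
    unfolding 1 2 sum.distrib[symmetric] by (simp add: algebra_simps)
  also have "\<dots> = (\<Sum>k\<in>?S. \<Sum>i\<in>UNIV. u k i)"
    by (intro sum.cong refl) (simp only: one_match_per_slot of_nat_1 mult_1)
  finally have 3: "(\<Sum>(k, i, j)\<in>T. u k i) + (\<Sum>(k, i, j)\<in>T. u k j) = (\<Sum>k\<in>?S. \<Sum>i\<in>UNIV. u k i)" .
  have 4: "(\<Sum>(k, i, j)\<in>T. w i j) = (\<Sum>(i, j)\<in>arcs. w i j)"
  proof -
    have "bij_betw snd T arcs"
    proof (rule bij_betw_imageI)
      show "inj_on snd T"
        by (rule inj_onI, clarsimp) (metis tournamentD unique_slot)
      show "snd ` T = arcs"
        using tournamentD unique_slot by (force simp: arcs_def image_iff)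
    qed
    from sum.reindex_bij_betw[OF this, of "\<lambda>(i, j). w i j"] show ?thesis
      by (simp add: split_def)
  qed
  show ?thesis
    using 3 4 by (simp add: sum.distrib split_def)
qed

end

end

section \<open>One-factorizations\<close>

lemma extend_bij_betw:
  assumes "finite A" "finite B" "card A = card B" "X \<subseteq> A" "inj_on f X" "f ` X \<subseteq> B"
  obtains e where "bij_betw e A B" "\<And>x. x \<in> X \<Longrightarrow> e x = f x"
proof -
  have "card (A - X) = card (B - f ` X)"
    using assms by (simp add: card_Diff_subset card_image finite_subset)
  then obtain h where h: "bij_betw h (A - X) (B - f ` X)"
    using finite_same_card_bij[of "A - X" "B - f ` X"] assms by auto
  have "bij_betw f X (f ` X)"
    using assms by (simp add: inj_on_imp_bij_betw)
  then have "bij_betw (\<lambda>x. if x \<in> X then f x else h x) (X \<union> (A - X)) (f ` X \<union> (B - f ` X))"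
    using h by (rule bij_betw_disjoint_Un) auto
  moreover have "X \<union> (A - X) = A" "f ` X \<union> (B - f ` X) = B"
    using assms by auto
  ultimately show thesis
    using that[of "\<lambda>x. if x \<in> X then f x else h x"] by simp
qed

text \<open>The circle method: in round \<^term>\<open>r\<close>, team \<^term>\<open>N\<close> meets \<^term>\<open>r\<close>, and
  \<^term>\<open>a\<close>, \<^term>\<open>b\<close> \<open>< N\<close> meet if \<open>a + b\<close> is congruent to \<open>2 * r\<close> modulo the odd number \<^term>\<open>N\<close>.\<close>

definition circle :: "nat \<Rightarrow> nat \<Rightarrow> nat \<Rightarrow> nat" where
  "circle N r a =
     (if a = N then r
      else if a = r then N
      else if 2 * r + N - a \<ge> 2 * N then 2 * r - a - N
      else if 2 * r + N - a \<ge> N then 2 * r - a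
      else 2 * r + N - a)"

lemma circle_le: "r < N \<Longrightarrow> a \<le> N \<Longrightarrow> circle N r a \<le> N"
  by (auto simp: circle_def)

lemma circle_simps: "circle N r N = r" "r < N \<Longrightarrow> circle N r r = N"
  by (simp_all add: circle_def)

lemma circle_eq_iff:
  assumes "r < N" "a < N" "a \<noteq> r"
  shows "circle N r a = b \<longleftrightarrow> b < N \<and> (a + b = 2 * r \<or> a + b = 2 * r + N \<or> a + b + N = 2 * r)"
  using assms unfolding circle_def by (simp split: if_split) linarith

lemma circle_involution:
  assumes "r < N" "a \<le> N"
  shows "circle N r (circle N r a) = a"
proof -
  consider "a = N" | "a = r" | "a < N" "a \<noteq> r"
    using assms by linarith
  then show ?thesis
  proof cases
    case 3
    define b where "b = circle N r a"
    have b: "b < N" "a + b = 2 * r \<or> a + b = 2 * r + N \<or> a + b + N = 2 * r"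
      using circle_eq_iff[OF assms(1) 3, of b] b_def by simp_all
    then have "b \<noteq> r"
      using 3 by linarith
    then have "circle N r b = a"
      using circle_eq_iff[OF assms(1) b(1), of a] 3 b(2) by (simp add: add.commute)
    then show ?thesis
      by (simp add: b_def)
  qed (use assms in \<open>simp_all add: circle_simps\<close>)
qed

text \<open>A team meeting itself would need \<open>2 * a\<close> congruent to \<open>2 * r\<close>
  modulo the odd number \<open>N\<close>, hence \<open>a = r\<close>.\<close>

lemma circle_neq:
  assumes "odd N" "r < N" "a \<le> N"
  shows "circle N r a \<noteq> a"
proof -
  consider "a = N" | "a = r" | "a < N" "a \<noteq> r"
    using assms by linarith
  then show ?thesis
  proof cases
    case 3
    have "\<not> (a + a = 2 * r \<or> a + a = 2 * r + N \<or> a + a + N = 2 * r)"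
      using assms(1) 3(2) by presburger
    then show ?thesis
      using circle_eq_iff[OF assms(2) 3] by blast
  qed (use assms in \<open>simp_all add: circle_simps\<close>)
qed

lemma circle_unique:
  assumes "odd N" "a \<le> N" "b \<le> N" "a \<noteq> b"
  shows "\<exists>!r. r < N \<and> circle N r a = b"
proof -
  consider "a = N" | "b = N" "a < N" | "a < N" "b < N"
    using assms by linarith
  then show ?thesis
  proof cases
    case 1
    then show ?thesis
      using assms by (auto simp: circle_simps)
  next
    case 2
    have "r = a" if "r < N" "circle N r a = b" for r
      using that 2 circle_eq_iff[of r N a b] by force
    then show ?thesis
      using 2 by (intro ex1I[of _ a]) (auto simp: circle_simps)
  next
    case 3
    have iff: "circle N r a = b \<longleftrightarrow> a + b = 2 * r \<or> a + b = 2 * r + N \<or> a + b + N = 2 * r" if "r < N" for r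
    proof (cases "a = r")
      case True
      then show ?thesis
        using 3 that assms(4) by (simp add: circle_simps)
    next
      case False
      then show ?thesis
        using circle_eq_iff[of r N a b] that 3 by simp
    qed
    have "r = s" if "r < N" "s < N" "circle N r a = b" "circle N s a = b" for r s
    proof -
      have "2 * r = 2 * s \<or> 2 * r = 2 * s + N \<or> 2 * r + N = 2 * s \<or> r = s + N \<or> r + N = s"
        using that iff[of r] iff[of s] by auto
      moreover have "2 * r \<noteq> 2 * s + N" "2 * r + N \<noteq> 2 * s"
        using assms(1) by presburger+
      ultimately show ?thesis
        using that(1,2) by linarith
    qed
    moreover have "\<exists>r<N. circle N r a = b"
    proof -
      \<comment> \<open>Halving \<open>a + b\<close> modulo the odd number \<open>N\<close>: an odd
        sum is first corrected by \<open>N\<close>, in the direction that keeps the result below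
        \<open>N\<close>.\<close>
      define r where "r = (if even (a + b) then (a + b) div 2
        else if a + b < N then (a + b + N) div 2 else (a + b - N) div 2)"
      have "a + b = 2 * r \<or> a + b = 2 * r + N \<or> a + b + N = 2 * r"
      proof (cases "even (a + b)")
        case False
        then have "even (a + b + N)" "even (a + b - N)"
          using assms(1) by simp_all
        then have "2 * ((a + b + N) div 2) = a + b + N" "2 * ((a + b - N) div 2) = a + b - N"
          by (auto simp: even_two_times_div_two)
        with False show ?thesis
          by (simp add: r_def)
      qed (simp add: r_def)
      moreover from this have "r < N"
        using 3 by (auto simp: r_def split: if_splits)
      ultimately show ?thesis
        using iff by blast
    qed
    ultimately show ?thesis
      by blast
  qed
qed

text \<open>A round is a fixed-point-free involution sending each team to its opponent, and it is
  named by the team that \<open>t\<close> meets. Choosing the opponent of \<open>t\<close> in a slot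
  therefore chooses the whole matching.\<close>

definition factorization :: "'v \<Rightarrow> ('v \<Rightarrow> 'v \<Rightarrow> 'v) \<Rightarrow> bool" where
  "factorization t Q \<longleftrightarrow>
     (\<forall>r. r \<noteq> t \<longrightarrow> Q r t = r \<and> (\<forall>i. Q r (Q r i) = i \<and> Q r i \<noteq> i)) \<and>
     (\<forall>i j. i \<noteq> j \<longrightarrow> (\<exists>!r. r \<noteq> t \<and> Q r i = j))"

lemma factorizationD:
  assumes "factorization t Q"
  shows "r \<noteq> t \<Longrightarrow> Q r t = r" "r \<noteq> t \<Longrightarrow> Q r (Q r i) = i" "r \<noteq> t \<Longrightarrow> Q r i \<noteq> i"
    "i \<noteq> j \<Longrightarrow> \<exists>!r. r \<noteq> t \<and> Q r i = j"
  using assms by (auto simp: factorization_def)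

lemma factorization_eq_iff:
  assumes "factorization t Q" "r \<noteq> t"
  shows "Q r i = j \<longleftrightarrow> Q r j = i"
  using factorizationD(2)[OF assms, of i] factorizationD(2)[OF assms, of j] by auto

text \<open>Relabelling teams also renames the rounds, because \<open>t\<close> must still meet
  \<open>r\<close> in round \<open>r\<close>. A transposition fixing \<open>r\<close> thus changes
  the matching of round \<open>r\<close> only locally.\<close>

lemma factorization_conj:
  assumes Q: "factorization t Q" and s: "\<And>x. s (s x) = x" "s t = t"
  shows "factorization t (\<lambda>r i. s (Q (s r) (s i)))"
proof -
  have eq: "s x = y \<longleftrightarrow> x = s y" for x y
    using s(1)[of x] s(1)[of y] by auto
  have st: "s x = t \<longleftrightarrow> x = t" for x
    using s(1)[of x] s(2) by auto
  have "\<exists>!r. r \<noteq> t \<and> s (Q (s r) (s i)) = j" if "i \<noteq> j" for i j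
  proof -
    have "s i \<noteq> s j"
      using that s(1)[of i] s(1)[of j] by auto
    from factorizationD(4)[OF Q this] obtain r
      where r: "r \<noteq> t" "Q r (s i) = s j" "\<And>r'. r' \<noteq> t \<Longrightarrow> Q r' (s i) = s j \<Longrightarrow> r' = r"
      by auto
    show ?thesis
    proof (rule ex1I[of _ "s r"])
      show "s r \<noteq> t \<and> s (Q (s (s r)) (s i)) = j"
        using r(1,2) s(1) st by simp
      show "r' = s r" if "r' \<noteq> t \<and> s (Q (s r') (s i)) = j" for r'
        using r(3)[of "s r'"] that st[of r'] eq[of "Q (s r') (s i)" j] eq[of r' r] by auto
    qed
  qed
  moreover have "s (Q (s r) (s t)) = r" if "r \<noteq> t" for r
    using factorizationD(1)[OF Q, of "s r"] that s st[of r] by auto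
  moreover have "s (Q (s r) (s (s (Q (s r) (s i))))) = i" "s (Q (s r) (s i)) \<noteq> i" if "r \<noteq> t" for r i
    using factorizationD(2,3)[OF Q, of "s r" "s i"] that s(1) st[of r] eq[of "Q (s r) (s i)" i] by auto
  ultimately show ?thesis
    unfolding factorization_def by blast
qed

context teams
begin

text \<open>Team \<open>t\<close> must get the label \<open>N\<close>, the one that meets
  \<open>r\<close> in round \<open>r\<close> of the circle method.\<close>

lemma factorization_circle:
  assumes e: "bij_betw e (UNIV :: 'v set) {0..N}" and et: "e t = N"
  shows "factorization t (\<lambda>r i. inv e (circle N (e r) (e i)))"
proof -
  have inj: "inj e"
    using e by (simp add: bij_betw_def)
  have le: "e x \<le> N" for x
    using e by (auto simp: bij_betw_def)
  have lt: "e r < N" if "r \<noteq> t" for r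
    using le[of r] that et inj by (metis injD le_neq_implies_less)
  have inv: "e (inv e a) = a" if "a \<le> N" for a
    using that e by (auto simp: bij_betw_def f_inv_into_f)
  have c: "e (inv e (circle N (e r) (e i))) = circle N (e r) (e i)" if "r \<noteq> t" for r i
    by (intro inv circle_le lt le that)
  have "\<exists>!r. r \<noteq> t \<and> inv e (circle N (e r) (e i)) = j" if "i \<noteq> j" for i j
  proof -
    have "e i \<noteq> e j"
      using that inj by (simp add: inj_eq)
    then obtain a where a: "a < N" "circle N a (e i) = e j" "\<And>b. b < N \<Longrightarrow> circle N b (e i) = e j \<Longrightarrow> b = a"
      using circle_unique[OF odd_N le le] by blast
    show ?thesis
    proof (rule ex1I[of _ "inv e a"])
      have ea: "e (inv e a) = a"
        using a(1) by (intro inv) simp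
      then have "inv e a \<noteq> t"
        using a(1) et by auto
      then show "inv e a \<noteq> t \<and> inv e (circle N (e (inv e a)) (e i)) = j"
        using a(2) inj by (simp add: ea)
      show "r = inv e a" if r: "r \<noteq> t \<and> inv e (circle N (e r) (e i)) = j" for r
      proof -
        have "circle N (e r) (e i) = e j"
          using r c by auto
        then have "e r = a"
          using a(3) lt r by blast
        then show ?thesis
          using inj by auto
      qed
    qed
  qed
  moreover have "inv e (circle N (e r) (e t)) = r" for r
    using inj by (simp add: et circle_def)
  moreover have "inv e (circle N (e r) (e (inv e (circle N (e r) (e i))))) = i"
    "inv e (circle N (e r) (e i)) \<noteq> i" if r: "r \<noteq> t" for r i
  proof -
    show "inv e (circle N (e r) (e (inv e (circle N (e r) (e i))))) = i"
      using inj by (simp add: c[OF r] circle_involution[OF lt[OF r] le])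
    show "inv e (circle N (e r) (e i)) \<noteq> i"
      using circle_neq[OF odd_N lt[OF r] le, of i] c[OF r, of i] by auto
  qed
  ultimately show ?thesis
    unfolding factorization_def by blast
qed

lemma ex_factorization: "\<exists>Q. factorization t Q"
proof -
  obtain e where "bij_betw e (UNIV :: 'v set) {0..N}" "\<And>x. x \<in> {t} \<Longrightarrow> e x = N"
    by (rule extend_bij_betw[of UNIV "{0..N}" "{t}" "\<lambda>_. N"]) (auto simp: card_teams)
  then show ?thesis
    using factorization_circle by blast
qed

lemma ex_factorization_pairs:
  assumes d: "distinct [t, i, j, m, p]"
  shows "\<exists>Q r. factorization t Q \<and> r \<noteq> t \<and> Q r i = j \<and> Q r m = p"
proof -
  have "card {t, i, j, m, p} \<le> CARD('v)"
    by (rule card_mono) auto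
  moreover have "card {t, i, j, m, p} = 5"
    using d by simp
  \<comment> \<open>Five teams only give \<open>4 \<le> N\<close>; parity excludes 4.\<close>
  ultimately have "5 \<le> N"
    using card_teams odd_N by (cases "N = 4") auto
  \<comment> \<open>In round 0 the labels \<open>a\<close> and \<open>N - a\<close> meet for
    \<open>0 < a < N\<close>. So \<open>i\<close>, \<open>j\<close> and \<open>m\<close>,
    \<open>p\<close> get two complementary pairs of labels, which are distinct as
    \<open>5 \<le> N\<close>.\<close>
  define f where "f = (\<lambda>_. 0)(t := N, i := 1, j := N - 1, m := 2, p := N - 2)"
  have f: "f t = N" "f i = 1" "f j = N - 1" "f m = 2" "f p = N - 2"
    using d by (auto simp: f_def)
  obtain e where e: "bij_betw e (UNIV :: 'v set) {0..N}" and ef: "\<And>x. x \<in> {t, i, j, m, p} \<Longrightarrow> e x = f x"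
  proof (rule extend_bij_betw[of UNIV "{0..N}" "{t, i, j, m, p}" f])
    show "inj_on f {t, i, j, m, p}"
      using \<open>5 \<le> N\<close> d by (auto simp: f)
  qed (use \<open>5 \<le> N\<close> card_teams in \<open>auto simp: f\<close>)
  have ev: "e t = N" "e i = 1" "e j = N - 1" "e m = 2" "e p = N - 2"
    using ef f by auto
  have inj: "inj e"
    using e by (simp add: bij_betw_def)
  have e0: "e (inv e 0) = 0"
    using e by (auto simp: bij_betw_def f_inv_into_f)
  have "circle N 0 1 = N - 1" "circle N 0 2 = N - 2"
    using \<open>5 \<le> N\<close> by (auto simp: circle_def)
  then have "inv e (circle N (e (inv e 0)) (e i)) = j" "inv e (circle N (e (inv e 0)) (e m)) = p"
    using e0 ev inj by (metis inv_f_f)+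
  moreover have "inv e 0 \<noteq> t"
    using e0 ev \<open>5 \<le> N\<close> by auto
  ultimately show ?thesis
    using factorization_circle[OF e ev(1)] by blast
qed

section \<open>Away sets and opponent sequences of \<open>t\<close>\<close>

definition admissible :: "nat set \<Rightarrow> (nat \<Rightarrow> 'v) \<Rightarrow> bool" where
  "admissible A \<rho> \<longleftrightarrow> A \<subseteq> {1..2 * N} \<and> bij_betw \<rho> A (UNIV - {t}) \<and> bij_betw \<rho> ({1..2 * N} - A) (UNIV - {t})"

lemma ex_admissible:
  assumes A: "A \<subseteq> {1..2 * N}" "card A = N" and X: "X \<subseteq> {1..2 * N}"
    and f: "f ` X \<subseteq> UNIV - {t}" "inj_on f (X \<inter> A)" "inj_on f (X - A)"
  obtains \<rho> where "admissible A \<rho>" "\<And>x. x \<in> X \<Longrightarrow> \<rho> x = f x"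
proof -
  have V: "card (UNIV - {t}) = N"
    by (simp add: card_Diff_singleton card_teams)
  have fin: "finite A"
    using A finite_subset by blast
  have cB: "card ({1..2 * N} - A) = N"
    using A fin by (simp add: card_Diff_subset)
  obtain g where g: "bij_betw g A (UNIV - {t})" "\<And>x. x \<in> X \<inter> A \<Longrightarrow> g x = f x"
    by (rule extend_bij_betw[of A "UNIV - {t}" "X \<inter> A" f]) (use A V f fin in auto)
  obtain h where h: "bij_betw h ({1..2 * N} - A) (UNIV - {t})" "\<And>x. x \<in> X - A \<Longrightarrow> h x = f x"
    by (rule extend_bij_betw[of "{1..2 * N} - A" "UNIV - {t}" "X - A" f]) (use cB V X f in auto)
  let ?r = "\<lambda>x. if x \<in> A then g x else h x"
  have "bij_betw ?r A (UNIV - {t}) \<longleftrightarrow> bij_betw g A (UNIV - {t})"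
    by (rule bij_betw_cong) simp
  moreover have "bij_betw ?r ({1..2 * N} - A) (UNIV - {t}) \<longleftrightarrow> bij_betw h ({1..2 * N} - A) (UNIV - {t})"
    by (rule bij_betw_cong) simp
  ultimately have "bij_betw ?r A (UNIV - {t})" "bij_betw ?r ({1..2 * N} - A) (UNIV - {t})"
    using g(1) h(1) by blast+
  then show thesis
    using that[of ?r] A(1) g(2) h(2) unfolding admissible_def by auto
qed

end

section \<open>Tournaments from two one-factorizations\<close>

definition orientation :: "('v \<Rightarrow> 'v \<Rightarrow> bool) \<Rightarrow> bool" where
  "orientation d \<longleftrightarrow> (\<forall>i j. i \<noteq> j \<longrightarrow> d i j = (\<not> d j i))"

lemma orientationD: "orientation d \<Longrightarrow> i \<noteq> j \<Longrightarrow> d i j \<longleftrightarrow> \<not> d j i"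
  unfolding orientation_def by blast

text \<open>Letting one or two teams dominate all others prescribes the venues of the few matches to
  be exchanged; an arbitrary linear order decides the rest.\<close>

lemma ex_orientation:
  fixes X :: "'v::finite set"
  shows "\<exists>d. orientation d \<and> (\<forall>x\<in>X. \<forall>y. y \<notin> X \<longrightarrow> d x y)"
proof -
  obtain e :: "'v \<Rightarrow> nat" where e: "inj e"
    using finite_imp_inj_to_nat_seg[of "UNIV :: 'v set"] by auto
  let ?d = "\<lambda>x y. if x \<in> X \<longleftrightarrow> y \<in> X then e x < e y else x \<in> X"
  have "orientation ?d"
    unfolding orientation_def
  proof (intro allI impI)
    fix i j :: 'v assume "i \<noteq> j"
    then have "e i < e j \<or> e j < e i"
      using injD[OF e, of i j] by linarith
    then show "?d i j = (\<not> ?d j i)"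
      by auto
  qed
  moreover have "\<forall>x\<in>X. \<forall>y. y \<notin> X \<longrightarrow> ?d x y"
    by simp
  ultimately show ?thesis
    by (intro exI[of _ ?d] conjI)
qed

lemma ex1_unique: "\<exists>!x. P x \<Longrightarrow> P x \<Longrightarrow> P y \<Longrightarrow> x = y"
  by auto

lemma bij_betw_ex1:
  assumes "bij_betw f A B" "b \<in> B"
  shows "\<exists>!a. a \<in> A \<and> f a = b"
proof -
  obtain a where a: "a \<in> A" "f a = b"
    using assms bij_betw_imp_surj_on by blast
  then have "x = a" if "x \<in> A \<and> f x = b" for x
    using bij_betw_imp_inj_on[OF assms(1)] that by (auto dest: inj_onD)
  with a show ?thesis
    by blast
qed

lemma sum_of_bool_unique:
  assumes "finite A" "\<exists>!x. x \<in> A \<and> P x"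
  shows "(\<Sum>x\<in>A. of_bool (P x)) = (1::real)"
proof -
  obtain x where "x \<in> A \<and> P x" "\<forall>y. y \<in> A \<and> P y \<longrightarrow> y = x"
    using assms(2) by (rule ex1E)
  then have "A \<inter> {x. P x} = {x}"
    by blast
  then show ?thesis
    using assms(1) by (simp add: of_bool_def sum.If_cases)
qed

lemma sum_exchange:
  fixes a :: "'a \<Rightarrow> real"
  assumes "finite T" "finite Y" "X \<subseteq> T" "Y \<inter> T = {}" "T' = (T - X) \<union> Y"
  shows "sum a T - sum a T' = sum a X - sum a Y"
proof -
  have "sum a T' = sum a (T - X) + sum a Y"
    unfolding assms(5) using assms by (intro sum.union_disjoint) auto
  then show ?thesis
    using assms by (simp add: sum_diff finite_subset)
qed

context teams
begin

lemma admissibleD: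
  assumes "admissible A \<rho>"
  shows "A \<subseteq> {1..2 * N}" "k \<in> {1..2 * N} \<Longrightarrow> \<rho> k \<noteq> t"
    "j \<noteq> t \<Longrightarrow> \<exists>!k. k \<in> {1..2 * N} \<and> \<rho> k = j \<and> (k \<in> A) = b"
proof -
  have A: "A \<subseteq> {1..2 * N}" and 1: "bij_betw \<rho> A (UNIV - {t})" and 2: "bij_betw \<rho> ({1..2 * N} - A) (UNIV - {t})"
    using assms by (auto simp: admissible_def)
  show "A \<subseteq> {1..2 * N}"
    by (fact A)
  show "\<rho> k \<noteq> t" if "k \<in> {1..2 * N}"
    using bij_betwE[OF 1] bij_betwE[OF 2] that by (cases "k \<in> A") auto
  assume j: "j \<noteq> t"
  show "\<exists>!k. k \<in> {1..2 * N} \<and> \<rho> k = j \<and> (k \<in> A) = b"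
  proof (cases b)
    case True
    have "k \<in> {1..2 * N} \<and> \<rho> k = j \<and> (k \<in> A) = b \<longleftrightarrow> k \<in> A \<and> \<rho> k = j" for k
      using A True by auto
    then show ?thesis
      using bij_betw_ex1[OF 1, of j] j by simp
  next
    case False
    then show ?thesis
      using bij_betw_ex1[OF 2, of j] j by (simp add: conj_ac)
  qed
qed

lemma admissible_eq:
  assumes "admissible A \<rho>" "k \<in> {1..2 * N}" "l \<in> {1..2 * N}" "\<rho> k = \<rho> l" "k \<in> A \<longleftrightarrow> l \<in> A"
  shows "k = l"
  using ex1_unique[OF admissibleD(3)[OF assms(1) admissibleD(2)[OF assms(1,2)], of "k \<in> A"]]
    assms(2-5) by simp

text \<open>In slot \<^term>\<open>k\<close> the matching with which \<^term>\<open>t\<close> meets \<^term>\<open>\<rho> k\<close> is taken from one of two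
  factorizations of the complete graph. Each opponent of \<^term>\<open>t\<close> occurs once in the away slots \<^term>\<open>A\<close>
  and once in its complement, and \<^term>\<open>c\<close> tells for each opponent in which of the two slots
  the first factorization is used. The relation \<^term>\<open>d\<close> orients the remaining matches of the first
  factorization; those of the second are oriented oppositely.\<close>

definition schedule ::
    "nat set \<Rightarrow> (nat \<Rightarrow> 'v) \<Rightarrow> ('v \<Rightarrow> bool) \<Rightarrow> ('v \<Rightarrow> 'v \<Rightarrow> bool) \<Rightarrow> (bool \<Rightarrow> 'v \<Rightarrow> 'v \<Rightarrow> 'v) \<Rightarrow> (nat \<times> 'v \<times> 'v) set" where
  "schedule A \<rho> c d Q = {(k, i, j). k \<in> {1..2 * N} \<and> i \<noteq> j \<and> Q ((k \<in> A) = c (\<rho> k)) (\<rho> k) i = j \<and>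
     (if i = t then k \<notin> A else if j = t then k \<in> A else d i j = ((k \<in> A) = c (\<rho> k)))}"

context
  fixes A :: "nat set" and \<rho> :: "nat \<Rightarrow> 'v" and c :: "'v \<Rightarrow> bool" and d :: "'v \<Rightarrow> 'v \<Rightarrow> bool"
    and Q :: "bool \<Rightarrow> 'v \<Rightarrow> 'v \<Rightarrow> 'v"
  assumes adm: "admissible A \<rho>" and d: "orientation d" and Q: "\<And>q. factorization t (Q q)"
begin

lemma schedule_home: "(k, t, j) \<in> schedule A \<rho> c d Q \<longleftrightarrow> k \<in> {1..2 * N} - A \<and> \<rho> k = j"
  using admissibleD(2)[OF adm, of k] factorizationD(1)[OF Q, of "\<rho> k"] by (auto simp: schedule_def)

lemma schedule_away: "(k, i, t) \<in> schedule A \<rho> c d Q \<longleftrightarrow> k \<in> A \<and> \<rho> k = i"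
proof (cases "k \<in> {1..2 * N}")
  case True
  have "Q ((k \<in> A) = c (\<rho> k)) (\<rho> k) i = t \<longleftrightarrow> \<rho> k = i"
    using admissibleD(2)[OF adm True] factorizationD(1)[OF Q] factorization_eq_iff[OF Q] by metis
  then show ?thesis
    using True admissibleD(2)[OF adm True] by (auto simp: schedule_def)
qed (use admissibleD(1)[OF adm] in \<open>auto simp: schedule_def\<close>)

text \<open>The match at venue \<open>i\<close> can only come from factorization
  \<open>Q (d i j)\<close>, the return match only from the other one. This is the effect of
  orienting the two factorizations oppositely.\<close>

lemma schedule_other:
  assumes "i \<noteq> t" "j \<noteq> t"
  shows "(k, i, j) \<in> schedule A \<rho> c d Q \<longleftrightarrow> k \<in> {1..2 * N} \<and> i \<noteq> j \<and> Q (d i j) (\<rho> k) i = j \<and>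
     (k \<in> A) = (c (\<rho> k) = d i j)"
  using assms by (cases "k \<in> A"; cases "c (\<rho> k)"; cases "d i j") (simp_all add: schedule_def)

lemma away_schedule: "away (schedule A \<rho> c d Q) t = A"
  by (auto simp: away_def schedule_away)

text \<open>For a pair avoiding \<open>t\<close>, one round \<open>r\<close> of the relevant
  factorization contains it. Team \<open>t\<close> meets \<open>r\<close> in one away and one home
  slot, and \<open>c r\<close> decides which of the two uses this factorization.\<close>

lemma schedule_unique_slot:
  assumes "i \<noteq> j"
  shows "\<exists>!k. k \<in> {1..2 * N} \<and> (k, i, j) \<in> schedule A \<rho> c d Q"
proof -
  consider "i = t" | "j = t" | "i \<noteq> t" "j \<noteq> t"
    by blast
  then show ?thesis
  proof cases
    case 1
    then have "k \<in> {1..2 * N} \<and> (k, i, j) \<in> schedule A \<rho> c d Q \<longleftrightarrow> k \<in> {1..2 * N} \<and> \<rho> k = j \<and> (k \<in> A) = False" for k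
      by (auto simp: schedule_home)
    then show ?thesis
      using admissibleD(3)[OF adm, of j False] assms 1 by simp
  next
    case 2
    have "k \<in> {1..2 * N} \<and> (k, i, j) \<in> schedule A \<rho> c d Q \<longleftrightarrow> k \<in> {1..2 * N} \<and> \<rho> k = i \<and> (k \<in> A) = True" for k
      using 2 by (auto simp: schedule_away)
    then show ?thesis
      using admissibleD(3)[OF adm, of i True] assms 2 by simp
  next
    case 3
    obtain r where r: "r \<noteq> t" "Q (d i j) r i = j" "\<And>r'. r' \<noteq> t \<Longrightarrow> Q (d i j) r' i = j \<Longrightarrow> r' = r"
      using factorizationD(4)[OF Q assms, of "d i j"] by auto
    have "Q (d i j) (\<rho> k) i = j \<longleftrightarrow> \<rho> k = r" if "k \<in> {1..2 * N}" for k
      using r(2) r(3)[OF admissibleD(2)[OF adm that]] by auto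
    then have "k \<in> {1..2 * N} \<and> (k, i, j) \<in> schedule A \<rho> c d Q \<longleftrightarrow>
        k \<in> {1..2 * N} \<and> \<rho> k = r \<and> (k \<in> A) = (c r = d i j)" for k
      using 3 assms by (auto simp: schedule_other)
    then show ?thesis
      using admissibleD(3)[OF adm r(1), of "c r = d i j"] by simp
  qed
qed

lemma schedule_one_match:
  assumes k: "k \<in> {1..2 * N}" and "i \<noteq> j"
  shows "indicat_real (schedule A \<rho> c d Q) (k, i, j) + indicat_real (schedule A \<rho> c d Q) (k, j, i) =
    of_bool (Q ((k \<in> A) = c (\<rho> k)) (\<rho> k) i = j)"
proof -
  have sym: "Q ((k \<in> A) = c (\<rho> k)) (\<rho> k) j = i \<longleftrightarrow> Q ((k \<in> A) = c (\<rho> k)) (\<rho> k) i = j"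
    using factorization_eq_iff[OF Q admissibleD(2)[OF adm k]] by blast
  have "d i j \<longleftrightarrow> \<not> d j i"
    by (rule orientationD[OF d assms(2)])
  then show ?thesis
    using assms by (auto simp: schedule_def indicator_def sym)
qed

lemma tournament_schedule: "tournament (schedule A \<rho> c d Q)"
  unfolding tournament_def slots
proof (intro conjI ballI allI impI)
  show "schedule A \<rho> c d Q \<subseteq> matches"
  proof (rule subsetI, clarify)
    fix k i j assume "(k, i, j) \<in> schedule A \<rho> c d Q"
    then have "k \<in> {1..2 * N} \<and> i \<noteq> j"
      by (simp add: schedule_def)
    then show "(k, i, j) \<in> matches"
      unfolding mem_matches .
  qed
next
  fix k i assume k: "k \<in> {1..2 * N}"
  let ?o = "Q ((k \<in> A) = c (\<rho> k)) (\<rho> k) i"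
  have "(\<Sum>j\<in>UNIV - {i}. indicat_real (schedule A \<rho> c d Q) (k, i, j) + indicat_real (schedule A \<rho> c d Q) (k, j, i)) =
      (\<Sum>j\<in>UNIV - {i}. of_bool (?o = j))"
    by (rule sum.cong) (use schedule_one_match[OF k] in auto)
  also have "\<dots> = 1"
    by (rule sum_of_bool_unique) (use factorizationD(3)[OF Q admissibleD(2)[OF adm k]] in auto)
  finally show "(\<Sum>j\<in>UNIV - {i}. indicat_real (schedule A \<rho> c d Q) (k, i, j) + indicat_real (schedule A \<rho> c d Q) (k, j, i)) = 1" .
next
  fix p :: "'v \<times> 'v" assume "p \<in> arcs"
  then obtain i j where p: "p = (i, j)" "i \<noteq> j"
    by (auto simp: arcs_def)
  have "(\<Sum>k\<in>{1..2 * N}. of_bool ((k, i, j) \<in> schedule A \<rho> c d Q)) = (1::real)"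
    by (rule sum_of_bool_unique[OF _ schedule_unique_slot[OF p(2)]]) simp
  then show "case p of (i, j) \<Rightarrow> (\<Sum>k\<in>{1..2 * N}. indicat_real (schedule A \<rho> c d Q) (k, i, j)) = 1"
    by (simp add: p indicator_def of_bool_def)
qed

end

text \<open>With equal factorizations, \<open>i\<close> and \<open>j\<close> meet exactly in the two
  slots where \<open>t\<close> meets \<open>r\<close>, with opposite venues. Reversing this one edge
  of \<open>d\<close> exchanges the two venues and touches nothing else.\<close>

lemma schedule_flip:
  fixes Q :: "'v \<Rightarrow> 'v \<Rightarrow> 'v"
  assumes adm: "admissible A \<rho>" and d: "orientation d" and Q: "factorization t Q"
    and k: "k \<in> A" and l: "l \<in> {1..2 * N} - A" and r: "\<rho> k = r" "\<rho> l = r" "r \<noteq> t" "Q r i = j"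
    and ij: "i \<noteq> t" "j \<noteq> t" "d i j"
  defines "d' \<equiv> \<lambda>x y. if {x, y} = {i, j} then \<not> d x y else d x y"
  shows "orientation d'"
    and "schedule A \<rho> (\<lambda>_. True) d' (\<lambda>_. Q) =
      schedule A \<rho> (\<lambda>_. True) d (\<lambda>_. Q) - {(k, i, j), (l, j, i)} \<union> {(k, j, i), (l, i, j)}"
    and "{(k, i, j), (l, j, i)} \<subseteq> schedule A \<rho> (\<lambda>_. True) d (\<lambda>_. Q)"
    and "{(k, j, i), (l, i, j)} \<inter> schedule A \<rho> (\<lambda>_. True) d (\<lambda>_. Q) = {}"
proof -
  let ?T = "schedule A \<rho> (\<lambda>_. True) d (\<lambda>_. Q)" and ?T' = "schedule A \<rho> (\<lambda>_. True) d' (\<lambda>_. Q)"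
  show d': "orientation d'"
    unfolding orientation_def
  proof (intro allI impI)
    fix x y :: 'v assume "x \<noteq> y"
    then have "d x y \<longleftrightarrow> \<not> d y x"
      by (rule orientationD[OF d])
    moreover have "{y, x} = {x, y}"
      by auto
    ultimately show "d' x y = (\<not> d' y x)"
      by (simp add: d'_def)
  qed
  have kS: "k \<in> {1..2 * N}"
    using k admissibleD(1)[OF adm] by blast
  have neq: "i \<noteq> j"
    using factorizationD(3)[OF Q r(3), of i] r(4) by simp
  have dji: "\<not> d j i"
    using orientationD[OF d neq] ij(3) by simp
  have ex1: "\<rho> m = r" if "m \<in> {1..2 * N}" "Q (\<rho> m) i = j" for m
    using ex1_unique[OF factorizationD(4)[OF Q neq], of "\<rho> m" r] admissibleD(2)[OF adm that(1)] that(2) r(3,4) by blast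
  have slot: "m \<in> {1..2 * N} \<and> Q (\<rho> m) i = j \<longleftrightarrow> m = k \<or> m = l" for m
  proof
    assume m: "m \<in> {1..2 * N} \<and> Q (\<rho> m) i = j"
    show "m = k \<or> m = l"
    proof (cases "m \<in> A")
      case True
      then have "m = k"
        using m k kS r(1) ex1[of m] by (intro admissible_eq[OF adm]) auto
      then show ?thesis ..
    next
      case False
      then have "m = l"
        using m l r(2) ex1[of m] by (intro admissible_eq[OF adm]) auto
      then show ?thesis ..
    qed
  qed (use kS l r in auto)
  have slot': "m \<in> {1..2 * N} \<and> Q (\<rho> m) j = i \<longleftrightarrow> m = k \<or> m = l" for m
    using slot[of m] factorization_eq_iff[OF Q admissibleD(2)[OF adm], of m i j] by blast
  have T: "(m, i, j) \<in> ?T \<longleftrightarrow> m = k" "(m, j, i) \<in> ?T \<longleftrightarrow> m = l"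
    "(m, i, j) \<in> ?T' \<longleftrightarrow> m = l" "(m, j, i) \<in> ?T' \<longleftrightarrow> m = k" for m
  proof -
    have d'_ij: "\<not> d' i j" "d' j i"
      using ij(3) dji by (simp_all add: d'_def insert_commute)
    have kl: "k \<in> A" "l \<notin> A"
      using k l by auto
    show "(m, i, j) \<in> ?T \<longleftrightarrow> m = k"
      unfolding schedule_other[OF adm d Q ij(1,2)] using slot[of m] neq ij(3) kl by blast
    show "(m, j, i) \<in> ?T \<longleftrightarrow> m = l"
      unfolding schedule_other[OF adm d Q ij(2,1)] using slot'[of m] neq dji kl by blast
    show "(m, i, j) \<in> ?T' \<longleftrightarrow> m = l"
      unfolding schedule_other[OF adm d' Q ij(1,2)] using slot[of m] neq d'_ij kl by blast
    show "(m, j, i) \<in> ?T' \<longleftrightarrow> m = k"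
      unfolding schedule_other[OF adm d' Q ij(2,1)] using slot'[of m] neq d'_ij kl by blast
  qed
  have other: "(m, x, y) \<in> ?T' \<longleftrightarrow> (m, x, y) \<in> ?T" if "{x, y} \<noteq> {i, j}" for m x y
    using that by (simp add: schedule_def d'_def)
  have "(m, x, y) \<in> ?T' \<longleftrightarrow> (m, x, y) \<in> ?T - {(k, i, j), (l, j, i)} \<union> {(k, j, i), (l, i, j)}" for m x y
  proof (cases "{x, y} = {i, j}")
    case True
    then have "x = i \<and> y = j \<or> x = j \<and> y = i"
      by (auto simp: doubleton_eq_iff)
    then show ?thesis
      using T[of m] neq k l by auto
  next
    case False
    then show ?thesis
      using other[OF False, of m] by auto
  qed
  then show "?T' = ?T - {(k, i, j), (l, j, i)} \<union> {(k, j, i), (l, i, j)}"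
    by (intro set_eqI) (unfold split_paired_all)
  show "{(k, i, j), (l, j, i)} \<subseteq> ?T" "{(k, j, i), (l, i, j)} \<inter> ?T = {}"
    using T k l by auto
qed

text \<open>Exchanging the matchings of two slots whose union contains a 4-cycle through
  \<^term>\<open>i\<close>, \<^term>\<open>j\<close>, \<^term>\<open>m\<close>, \<^term>\<open>p\<close> and which agree elsewhere. The matchings are taken from a
  factorization and its conjugate under the transposition of \<^term>\<open>j\<close> and \<^term>\<open>p\<close>.\<close>

lemma schedule_cycle:
  assumes adm: "admissible A \<rho>" and d: "orientation d" and Q: "factorization t Q"
    and k: "k \<in> A" and l: "l \<in> {1..2 * N} - A" and r: "\<rho> k = r" "\<rho> l = r" "r \<noteq> t" "Q r i = j" "Q r m = p"
    and dist: "distinct [t, i, j, m, p]" and dX: "\<And>x y. x \<in> {i, m} \<Longrightarrow> y \<notin> {i, m} \<Longrightarrow> d x y"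
  defines "Q2 \<equiv> \<lambda>q. if q then Q else (\<lambda>r x. Transposition.transpose j p (Q (Transposition.transpose j p r) (Transposition.transpose j p x)))"
  defines "d' \<equiv> \<lambda>x y. if Q2 True r x = y \<and> Q2 False r x = y then \<not> d x y else d x y"
  defines "T \<equiv> schedule A \<rho> (\<lambda>_. True) d Q2"
  defines "T' \<equiv> schedule A \<rho> (\<lambda>x. x \<noteq> r) d' Q2"
  defines "X \<equiv> {(k, i, j), (k, m, p), (l, p, i), (l, j, m)}"
  defines "Y \<equiv> {(l, i, j), (l, m, p), (k, p, i), (k, j, m)}"
  shows "factorization t (Q2 q)" and "orientation d'"
    and "T' = T - X \<union> Y" and "X \<subseteq> T" and "Y \<inter> T = {}"
proof -
  have Q2: "factorization t (Q2 q)" for q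
    unfolding Q2_def using Q factorization_conj[OF Q, of "Transposition.transpose j p"] dist by simp
  then show "factorization t (Q2 q)" .
  have kS: "k \<in> {1..2 * N}" and lA: "l \<notin> A" and lS: "l \<in> {1..2 * N}"
    using k l admissibleD(1)[OF adm] by auto
  have Qs: "Q r j = i" "Q r p = m" "Q r r = t"
    using factorization_eq_iff[OF Q r(3)] factorizationD(1)[OF Q r(3)] r(4,5) by auto
  then have rn: "r \<noteq> i" "r \<noteq> j" "r \<noteq> m" "r \<noteq> p"
    using dist r(4,5) by auto
  let ?C = "{i, j, m, p}"
  have QC: "Q r x \<in> ?C \<longleftrightarrow> x \<in> ?C" for x
    using factorizationD(2)[OF Q r(3), of x] Qs r(4,5) by auto
  have Qt: "Q2 True r x = Q r x" for x
    by (simp add: Q2_def)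
  \<comment> \<open>The transposition of \<open>j\<close> and \<open>p\<close> fixes
    \<open>r\<close>, so in round \<open>r\<close> it replaces the edges \<open>ij\<close>,
    \<open>mp\<close> by \<open>ip\<close>, \<open>mj\<close> and keeps all others.\<close>
  have Qf: "Q2 False r i = p" "Q2 False r p = i" "Q2 False r m = j" "Q2 False r j = m"
    using dist rn r(4,5) Qs by (auto simp: Q2_def transpose_apply_other)
  have Qf': "Q2 False r x = Q r x" if "x \<notin> ?C" for x
    using that QC[of x] rn by (auto simp: Q2_def transpose_apply_other)
  have sym: "Q2 q r x = y \<longleftrightarrow> Q2 q r y = x" for q x y
    using factorization_eq_iff[OF Q2 r(3)] .
  show d': "orientation d'"
    unfolding orientation_def
  proof (intro allI impI)
    fix x y :: 'v assume "x \<noteq> y"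
    then have "d x y \<longleftrightarrow> \<not> d y x"
      by (rule orientationD[OF d])
    then show "d' x y = (\<not> d' y x)"
      unfolding d'_def sym[of True x y] sym[of False x y] by simp
  qed
  have idx: "\<rho> k' = r" if "k' \<in> {1..2 * N}" "Q2 q (\<rho> k') x = y" "Q2 q r x = y" "x \<noteq> y" for k' q x y
    using ex1_unique[OF factorizationD(4)[OF Q2 that(4)], of "\<rho> k'" q r]
      admissibleD(2)[OF adm that(1)] that(2,3) r(3) by blast
  have kl: "k' = k \<or> k' = l" if "k' \<in> {1..2 * N}" "\<rho> k' = r" for k'
  proof (cases "k' \<in> A")
    case True
    then have "k' = k"
      using that kS k r(1) by (intro admissible_eq[OF adm]) auto
    then show ?thesis ..
  next
    case False
    then have "k' = l"
      using that l r(2) by (intro admissible_eq[OF adm]) auto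
    then show ?thesis ..
  qed
  have d_iff: "d i j" "d m p" "d i p" "d m j" "\<not> d j i" "\<not> d p m" "\<not> d p i" "\<not> d j m"
    using dX dist orientationD[OF d, of i j] orientationD[OF d, of i p]
      orientationD[OF d, of m j] orientationD[OF d, of m p] by auto
  have mem: "(k', x, y) \<in> T \<longleftrightarrow> k' \<in> {1..2 * N} \<and> x \<noteq> y \<and> Q2 (d x y) (\<rho> k') x = y \<and> (k' \<in> A) = d x y"
    "(k', x, y) \<in> T' \<longleftrightarrow> k' \<in> {1..2 * N} \<and> x \<noteq> y \<and> Q2 (d' x y) (\<rho> k') x = y \<and> (k' \<in> A) = ((\<rho> k' \<noteq> r) = d' x y)"
    if "x \<noteq> t" "y \<noteq> t" for k' x y
    unfolding T_def T'_def schedule_other[OF adm d Q2 that] schedule_other[OF adm d' Q2 that] by auto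
  have slot_k: "(k, x, y) \<in> T \<longleftrightarrow> x \<noteq> y \<and> Q r x = y \<and> d x y"
    "(k, x, y) \<in> T' \<longleftrightarrow> x \<noteq> y \<and> Q2 False r x = y \<and> \<not> d' x y" if "x \<noteq> t" "y \<noteq> t" for x y
    unfolding mem[OF that] r(1) using k kS Qt[of x] by (cases "d x y"; cases "d' x y"; simp)+
  have slot_l: "(l, x, y) \<in> T \<longleftrightarrow> x \<noteq> y \<and> Q2 False r x = y \<and> \<not> d x y"
    "(l, x, y) \<in> T' \<longleftrightarrow> x \<noteq> y \<and> Q r x = y \<and> d' x y" if "x \<noteq> t" "y \<noteq> t" for x y
    unfolding mem[OF that] r(2) using lA lS Qt[of x] by (cases "d x y"; cases "d' x y"; simp)+
  have "(k', x, y) \<in> T' \<longleftrightarrow> (k', x, y) \<in> T - X \<union> Y" for k' x y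
  proof -
    consider "x = t" | "y = t" | "x \<noteq> t" "y \<noteq> t" "k' \<noteq> k" "k' \<noteq> l"
      | "x \<noteq> t" "y \<noteq> t" "x \<in> ?C" "k' = k \<or> k' = l" | "x \<noteq> t" "y \<noteq> t" "x \<notin> ?C" "k' = k \<or> k' = l"
      by blast
    then show ?thesis
    proof cases
      case 1
      then show ?thesis
        using dist unfolding T_def T'_def X_def Y_def
        by (simp add: schedule_home[OF adm d Q2] schedule_home[OF adm d' Q2])
    next
      case 2
      then show ?thesis
        using dist unfolding T_def T'_def X_def Y_def
        by (simp add: schedule_away[OF adm d Q2] schedule_away[OF adm d' Q2])
    next
      case 3
      \<comment> \<open>\<open>d'\<close> differs from \<open>d\<close> only on edges that both
        factorizations place in round \<open>r\<close>; these do not occur in slots with another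
        opponent of \<open>t\<close>.\<close>
      have nr: "\<rho> k' \<noteq> r" if "k' \<in> {1..2 * N}"
        using kl[OF that] 3 by blast
      have same: "d' x y = d x y" if "k' \<in> {1..2 * N}" "x \<noteq> y" "Q2 q (\<rho> k') x = y" for q
      proof (rule ccontr)
        assume "d' x y \<noteq> d x y"
        then have "Q2 q r x = y"
          unfolding d'_def by (cases q) (auto split: if_splits)
        then show False
          using idx[OF that(1,3) _ that(2)] nr that by blast
      qed
      have "(k', x, y) \<in> T' \<longleftrightarrow> (k', x, y) \<in> T"
      proof (cases "d' x y = d x y")
        case True
        then show ?thesis
          unfolding mem[OF 3(1,2)] using nr by auto
      next
        case False
        then show ?thesis
          unfolding mem[OF 3(1,2)] using same by blast
      qed
      then show ?thesis
        using 3 by (simp add: X_def Y_def)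
    next
      case 4
      have ne: "i \<noteq> j" "i \<noteq> m" "i \<noteq> p" "j \<noteq> m" "j \<noteq> p" "m \<noteq> p" "k \<noteq> l"
        using dist k lA by auto
      \<comment> \<open>On the 4-cycle the two matchings share no edge, so orientations are kept and
        matches change slot without changing venue.\<close>
      have "Q r x \<noteq> Q2 False r x"
        using 4(3) ne by (elim insertE) (simp_all add: Qf r(4,5) Qs)
      then have d'_eq: "d' x y = d x y"
        unfolding d'_def Qt by auto
      have X: "(k, x, y) \<in> X \<longleftrightarrow> x = i \<and> y = j \<or> x = m \<and> y = p" "(l, x, y) \<in> X \<longleftrightarrow> x = p \<and> y = i \<or> x = j \<and> y = m"
        and Y: "(l, x, y) \<in> Y \<longleftrightarrow> x = i \<and> y = j \<or> x = m \<and> y = p" "(k, x, y) \<in> Y \<longleftrightarrow> x = p \<and> y = i \<or> x = j \<and> y = m"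
        using ne(7) by (auto simp: X_def Y_def)
      have 1: "x \<noteq> y \<and> Q r x = y \<and> d x y \<longleftrightarrow> x = i \<and> y = j \<or> x = m \<and> y = p"
        using 4(3) ne d_iff by (elim insertE) (auto simp: r(4,5) Qs)
      have 2: "x \<noteq> y \<and> Q2 False r x = y \<and> \<not> d x y \<longleftrightarrow> x = p \<and> y = i \<or> x = j \<and> y = m"
        using 4(3) ne d_iff by (elim insertE) (auto simp: Qf)
      from 4(4) show ?thesis
        unfolding Un_iff Diff_iff using X Y slot_k[OF 4(1,2)] slot_l[OF 4(1,2)] 1 2 d'_eq by (elim disjE) (simp_all, blast+)
    next
      case 5
      \<comment> \<open>Off the cycle both slots carry the same edges, and changing
        \<open>c r\<close> alone would swap their venues; the reversal in \<open>d'\<close> undoes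
        this.\<close>
      have "d' x y \<longleftrightarrow> \<not> d x y" if "Q r x = y"
        unfolding d'_def Qt Qf'[OF 5(3)] using that by simp
      then have "(k', x, y) \<in> T' \<longleftrightarrow> (k', x, y) \<in> T"
        using 5(4) slot_k[OF 5(1,2)] slot_l[OF 5(1,2)] Qf'[OF 5(3)] by (elim disjE) (simp_all, blast+)
      moreover have "(k', x, y) \<notin> X" "(k', x, y) \<notin> Y"
        using 5(3) by (auto simp: X_def Y_def)
      ultimately show ?thesis
        by blast
    qed
  qed
  then show "T' = T - X \<union> Y"
    by (intro set_eqI) (unfold split_paired_all)
  have neq: "i \<noteq> t" "j \<noteq> t" "m \<noteq> t" "p \<noteq> t"
    using dist by auto
  have "{(k, i, j), (k, m, p), (l, p, i), (l, j, m)} \<subseteq> T"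
    using dist d_iff slot_k[OF neq(1,2)] slot_k[OF neq(3,4)] slot_l[OF neq(4,1)] slot_l[OF neq(2,3)]
    by (auto simp: Qf r(4,5))
  then show "X \<subseteq> T"
    by (simp add: X_def)
  have "{(l, i, j), (l, m, p), (k, p, i), (k, j, m)} \<inter> T = {}"
    using dist d_iff slot_l[OF neq(1,2)] slot_l[OF neq(3,4)] slot_k[OF neq(4,1)] slot_k[OF neq(2,3)]
    by (auto simp: Qf Qs r(4,5))
  then show "Y \<inter> T = {}"
    by (simp add: Y_def)
qed

end

section \<open>Away patterns on the face\<close>

text \<open>The four inequalities are the four choices of \<open>out\<close> (trips leaving home or
  returning) and \<open>home\<close> (home or away matches in the two slots).\<close>

locale facet_setting = teams t N for t :: "'v::card2" and N :: nat +
  fixes out home :: bool and k0 :: nat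
  assumes k0: "1 \<le> k0" "k0 \<le> N"
begin

text \<open>The value of the match terms of the inequality, not its slack: it counts those of the
  slots \<open>k0\<close> and \<open>k0 + N\<close> in which \<open>t\<close> plays at the kind of
  venue selected by \<open>home\<close>.\<close>

definition slack :: "nat set \<Rightarrow> nat" where
  "slack A = of_bool ((k0 \<in> A) \<noteq> home) + of_bool ((k0 + N \<in> A) \<noteq> home)"

definition tight :: "nat set \<Rightarrow> bool" where
  "tight A \<longleftrightarrow> A \<subseteq> {1..2 * N} \<and> card A = N \<and> card (turns out A) + slack A = 2"

lemma turns_block: "1 \<le> p \<Longrightarrow> turns out {p..<p + N} = {if out then p else p + N - 1}"
  using N_ge by (auto simp: turns_def)

lemma slack_block: "1 \<le> p \<Longrightarrow> p \<le> N + 1 \<Longrightarrow> slack {p..<p + N} = 1"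
  unfolding slack_def using k0 N_ge by (cases home) auto

lemma tight_block: "1 \<le> p \<Longrightarrow> p \<le> N + 1 \<Longrightarrow> tight {p..<p + N}"
  using N_ge by (auto simp: tight_def turns_block slack_block)

text \<open>For \<open>out\<close> the first away slot is always a turn, so every other away slot
  has its predecessor in \<open>A\<close> and one descends from the last. For returning trips one
  ascends from the first slot.\<close>

lemma block_of_single_turn:
  assumes A: "A \<subseteq> {1..2 * N}" "card A = N" and single: "\<exists>x. turns out A \<subseteq> {x}"
  shows "\<exists>p. 1 \<le> p \<and> p \<le> N + 1 \<and> A = {p..<p + N}"
proof -
  have fin: "finite A"
    using A(1) finite_subset by blast
  have "A \<noteq> {}"
    using A(2) N_ge by auto
  define a b where "a = Min A" and "b = Max A"
  have ab: "a \<in> A" "b \<in> A" "\<And>x. x \<in> A \<Longrightarrow> a \<le> x \<and> x \<le> b"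
    using fin \<open>A \<noteq> {}\<close> by (simp_all add: a_def b_def)
  have "{a..b} \<subseteq> A"
  proof (cases out)
    case True
    have "1 \<le> a"
      using ab(1) A(1) by auto
    then have "a - 1 \<notin> A"
      using ab(3)[of "a - 1"] by linarith
    then have step: "x - 1 \<in> A" if "x \<in> A" "x \<noteq> a" for x
      using single that ab(1) True by (auto simp: turns_def)
    have down: "b - d \<in> A" if "a \<le> b - d" for d
      using that
    proof (induction d)
      case (Suc d)
      then have "b - d \<in> A" "b - d \<noteq> a"
        using \<open>1 \<le> a\<close> by auto
      then have "b - d - 1 \<in> A"
        by (rule step)
      then show ?case
        by simp
    qed (use ab in simp)
    show ?thesis
    proof
      fix x assume "x \<in> {a..b}"
      then show "x \<in> A"
        using down[of "b - x"] by simp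
    qed
  next
    case False
    have "Suc b \<notin> A"
      using ab(3)[of "Suc b"] by auto
    then have step: "Suc x \<in> A" if "x \<in> A" "x \<noteq> b" for x
      using single that ab(2) False by (auto simp: turns_def)
    have up: "a + d \<in> A" if "a + d \<le> b" for d
      using that
    proof (induction d)
      case (Suc d)
      then have "a + d \<in> A" "a + d \<noteq> b"
        by auto
      then have "Suc (a + d) \<in> A"
        by (rule step)
      then show ?case
        by simp
    qed (use ab in simp)
    show ?thesis
    proof
      fix x assume "x \<in> {a..b}"
      then show "x \<in> A"
        using up[of "x - a"] by simp
    qed
  qed
  then have eq: "A = {a..b}"
    using ab by auto
  then have "Suc b - a = N"
    using A(2) by simp
  then have "A = {a..<a + N}"
    using eq N_ge by auto
  moreover have "1 \<le> a" "b \<le> 2 * N"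
    using ab A(1) by auto
  moreover from this have "a \<le> N + 1"
    using \<open>Suc b - a = N\<close> N_ge by linarith
  ultimately show ?thesis
    by blast
qed

lemma turns_slack_ge:
  assumes A: "A \<subseteq> {1..2 * N}" "card A = N"
  shows "2 \<le> card (turns out A) + slack A"
proof (cases "\<exists>x. turns out A \<subseteq> {x}")
  case True
  then obtain p where "1 \<le> p" "p \<le> N + 1" "A = {p..<p + N}"
    using block_of_single_turn[OF A] by blast
  then show ?thesis
    by (simp add: turns_block slack_block)
next
  case False
  have "finite (turns out A)"
    using A(1) finite_subset[of A] by (simp add: turns_def)
  moreover have "card (turns out A) \<noteq> 0" "card (turns out A) \<noteq> 1"
    using False \<open>finite (turns out A)\<close> by (auto simp: card_1_singleton_iff)
  ultimately show ?thesis
    by linarith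
qed

text \<open>Being away in both \<open>k0\<close> and \<open>k0 + N\<close> makes the match terms
  vanish; the gap at \<open>q\<close> pays for this with a second trip.\<close>

lemma tight_home:
  assumes home and q: "k0 < q" "q < k0 + N"
  shows "tight ({k0..k0 + N} - {q})" and "card (turns out ({k0..k0 + N} - {q})) = 2"
proof -
  let ?A = "{k0..k0 + N} - {q}"
  have "turns out ?A = (if out then {k0, Suc q} else {q - 1, k0 + N})"
    using q k0 by (auto simp: turns_def)
  then show c: "card (turns out ?A) = 2"
    using q by simp
  have "card ?A = N"
    using q by simp
  then show "tight ?A"
    unfolding tight_def slack_def using c q k0 \<open>home\<close> by auto
qed

text \<open>Here both \<open>k0\<close> and \<open>k0 + N\<close> are home slots. Only
  \<open>N - 1\<close> slots lie between them, so one isolated slot \<open>q\<close> outside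
  completes the away set.\<close>

lemma tight_away:
  assumes "\<not> home" and q: "q \<in> {1..2 * N} - {k0..k0 + N}"
  shows "tight (insert q {k0<..<k0 + N})" and "card (turns out (insert q {k0<..<k0 + N})) = 2"
proof -
  let ?A = "insert q {k0<..<k0 + N}"
  have "turns out ?A = (if out then {q, Suc k0} else {q, k0 + N - 1})"
    using q k0 N_ge by (auto simp: turns_def)
  moreover have "q \<noteq> Suc k0" "q \<noteq> k0 + N - 1"
    using q k0 N_ge by auto
  ultimately show c: "card (turns out ?A) = 2"
    by simp
  have "card ?A = N"
    using q N_ge by auto
  then show "tight ?A"
    unfolding tight_def slack_def using c q k0 \<open>\<not> home\<close> by auto
qed

section \<open>Coefficients of the matches of \<open>t\<close>\<close>

context
  fixes v h :: "nat \<Rightarrow> 'v \<Rightarrow> real" and \<beta> :: "'v \<Rightarrow> real" and C :: real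
  assumes const: "\<And>A \<rho>. tight A \<Longrightarrow> admissible A \<rho> \<Longrightarrow>
    (\<Sum>k\<in>A. v k (\<rho> k)) + (\<Sum>k\<in>{1..2 * N} - A. h k (\<rho> k)) + (\<Sum>k\<in>turns out A. \<beta> (\<rho> k)) = C"
begin

text \<open>The coefficient of a trip is charged to the slot where the trip turns, which makes the
  whole functional a sum over slots.\<close>

private definition W :: "nat set \<Rightarrow> nat \<Rightarrow> 'v \<Rightarrow> real" where
  "W A k j = (if k \<in> A then v k j + of_bool (k \<in> turns out A) * \<beta> j else h k j)"

private lemma sum_W:
  assumes "tight A" "admissible A \<rho>"
  shows "(\<Sum>k\<in>{1..2 * N}. W A k (\<rho> k)) = C"
proof -
  have A: "A \<subseteq> {1..2 * N}" and fin: "finite A"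
    using assms(1) finite_subset[of A] by (auto simp: tight_def)
  have "(\<Sum>k\<in>{1..2 * N}. W A k (\<rho> k)) = (\<Sum>k\<in>{1..2 * N} - A. W A k (\<rho> k)) + (\<Sum>k\<in>A. W A k (\<rho> k))"
    using A by (intro sum.subset_diff) auto
  also have "(\<Sum>k\<in>{1..2 * N} - A. W A k (\<rho> k)) = (\<Sum>k\<in>{1..2 * N} - A. h k (\<rho> k))"
    by (rule sum.cong) (auto simp: W_def)
  also have "(\<Sum>k\<in>A. W A k (\<rho> k)) = (\<Sum>k\<in>A. v k (\<rho> k)) + (\<Sum>k\<in>A. of_bool (k \<in> turns out A) * \<beta> (\<rho> k))"
    by (simp add: W_def sum.distrib)
  also have "(\<Sum>k\<in>A. of_bool (k \<in> turns out A) * \<beta> (\<rho> k)) = (\<Sum>k\<in>turns out A. \<beta> (\<rho> k))"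
    using fin by (intro sum.mono_neutral_cong_right) (auto simp: turns_def)
  finally show ?thesis
    using const[OF assms] by simp
qed

text \<open>Letting slots \<open>k\<close> and \<open>l\<close> trade opponents leaves the away set,
  and hence tightness, unchanged.\<close>

private lemma W_exchange:
  assumes A: "tight A" and kl: "k \<in> {1..2 * N}" "l \<in> {1..2 * N}" "k \<in> A \<longleftrightarrow> l \<in> A"
    and ij: "i \<noteq> t" "j \<noteq> t"
  shows "W A k i - W A k j = W A l i - W A l j"
proof (cases "k = l \<or> i = j")
  case False
  have AS: "A \<subseteq> {1..2 * N}" "card A = N"
    using A by (simp_all add: tight_def)
  obtain \<rho> where \<rho>: "admissible A \<rho>" "\<And>x. x \<in> {k, l} \<Longrightarrow> \<rho> x = (if x = k then i else j)"
    by (rule ex_admissible[OF AS, of "{k, l}" "\<lambda>x. if x = k then i else j"])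
      (use kl ij False in \<open>auto simp: inj_on_def\<close>)
  have rk: "\<rho> k = i" "\<rho> l = j"
    using \<rho>(2) False by auto
  let ?s = "Transposition.transpose k l"
  have "bij_betw ?s B B" if "k \<in> B \<longleftrightarrow> l \<in> B" for B
    using that by (intro bij_betw_byWitness[of _ ?s]) (auto simp: Transposition.transpose_def)
  then have "bij_betw ?s A A" "bij_betw ?s ({1..2 * N} - A) ({1..2 * N} - A)"
    using kl by auto
  then have adm': "admissible A (\<rho> \<circ> ?s)"
    using \<rho>(1) unfolding admissible_def by (blast intro: bij_betw_trans)
  have split: "(\<Sum>x\<in>{1..2 * N}. f x) = f k + f l + (\<Sum>x\<in>{1..2 * N} - {k, l}. f x)" for f :: "nat \<Rightarrow> real"
    using kl False sum.subset_diff[of "{k, l}" "{1..2 * N}" f] by simp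
  have "(\<Sum>x\<in>{1..2 * N} - {k, l}. W A x ((\<rho> \<circ> ?s) x)) = (\<Sum>x\<in>{1..2 * N} - {k, l}. W A x (\<rho> x))"
    by (rule sum.cong) (auto simp: Transposition.transpose_def)
  then have "W A k j + W A l i = W A k i + W A l j"
    using sum_W[OF A \<rho>(1)] sum_W[OF A adm'] rk
    unfolding split[of "\<lambda>x. W A x (\<rho> x)"] split[of "\<lambda>x. W A x ((\<rho> \<circ> ?s) x)"] by simp
  then show ?thesis
    by linarith
qed auto

private lemma block_exchange:
  assumes "1 \<le> p" "p \<le> N + 1" "k \<in> {p..<p + N}" "l \<in> {p..<p + N}" "i \<noteq> t" "j \<noteq> t"
    and e: "e = (if out then p else p + N - 1)"
  shows "v k i + of_bool (k = e) * \<beta> i - (v k j + of_bool (k = e) * \<beta> j) =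
    v l i + of_bool (l = e) * \<beta> i - (v l j + of_bool (l = e) * \<beta> j)"
proof -
  have "W {p..<p + N} k i - W {p..<p + N} k j = W {p..<p + N} l i - W {p..<p + N} l j"
    by (rule W_exchange[OF tight_block[OF assms(1,2)]]) (use assms in auto)
  then show ?thesis
    unfolding W_def turns_block[OF assms(1)] e using assms(3,4) by simp
qed

text \<open>The same two neighbouring away slots are compared in two blocks. In just one of the
  blocks, one of these slots is the turn; subtracting the two relations leaves only the trip
  coefficients.\<close>

private lemma leg_coeff_const:
  assumes "i \<noteq> t" "j \<noteq> t"
  shows "\<beta> i = \<beta> j"
proof (cases out)
  case True
  show ?thesis
    using block_exchange[of 1 2 3 i j 1] block_exchange[of 2 2 3 i j 2] N_ge assms True by simp
next
  case False
  \<comment> \<open>For returning trips the slots compared are \<open>2 * N - 2\<close> and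
    \<open>2 * N - 1\<close>, written through \<open>M\<close> without subtraction.\<close>
  obtain M where M: "N = M + 3"
    using N_ge nat_le_iff_add[of 3 N] by (auto simp: add.commute)
  show ?thesis
    using block_exchange[of N "2 * M + 4" "2 * M + 5" i j "2 * M + 5"]
      block_exchange[of "N + 1" "2 * M + 4" "2 * M + 5" i j "2 * M + 6"] assms False by (simp add: M)
qed

private lemma away_diff:
  assumes "1 \<le> p" "p \<le> N + 1" "k \<in> {p..<p + N}" "l \<in> {p..<p + N}" "i \<noteq> t" "j \<noteq> t"
  shows "v k i - v k j = v l i - v l j"
proof -
  have "of_bool P * \<beta> i = of_bool P * \<beta> j" for P
    using leg_coeff_const[OF assms(5,6)] by simp
  then show ?thesis
    using block_exchange[OF assms refl] by simp
qed

private lemma home_diff: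
  assumes "1 \<le> p" "p \<le> N + 1" "k \<in> {1..2 * N} - {p..<p + N}" "l \<in> {1..2 * N} - {p..<p + N}" "i \<noteq> t" "j \<noteq> t"
  shows "h k i - h k j = h l i - h l j"
proof -
  have W: "W {p..<p + N} k x = h k x" "W {p..<p + N} l x = h l x" for x
    using assms(3,4) by (auto simp: W_def)
  have "W {p..<p + N} k i - W {p..<p + N} k j = W {p..<p + N} l i - W {p..<p + N} l j"
    by (rule W_exchange[OF tight_block[OF assms(1,2)]]) (use assms in auto)
  then show ?thesis
    by (simp only: W)
qed

text \<open>The blocks starting at 1, 2 and \<open>N + 1\<close> overlap enough to link every slot
  to slot 1.\<close>

private lemma away_diff_all:
  assumes "k \<in> {1..2 * N}" "i \<noteq> t" "j \<noteq> t"
  shows "v k i - v k j = v 1 i - v 1 j"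
proof (cases "k \<le> N")
  case True
  then show ?thesis
    using away_diff[of 1 k 1 i j] assms N_ge by simp
next
  case False
  then have "v k i - v k j = v (N + 1) i - v (N + 1) j"
    using away_diff[of "N + 1" k "N + 1" i j] assms N_ge by simp
  also have "\<dots> = v 2 i - v 2 j"
    using away_diff[of 2 "N + 1" 2 i j] assms N_ge by simp
  also have "\<dots> = v 1 i - v 1 j"
    using away_diff[of 1 2 1 i j] assms N_ge by simp
  finally show ?thesis .
qed

text \<open>The complements of the same three blocks form a chain, because that of the block
  starting at 2 contains both 1 and \<open>N + 2\<close>.\<close>

private lemma home_diff_all:
  assumes "k \<in> {1..2 * N}" "i \<noteq> t" "j \<noteq> t"
  shows "h k i - h k j = h 1 i - h 1 j"
proof (cases "k \<le> N")
  case True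
  then show ?thesis
    using home_diff[of "N + 1" k 1 i j] assms N_ge by simp
next
  case False
  then have "h k i - h k j = h (N + 2) i - h (N + 2) j"
    using home_diff[of 1 k "N + 2" i j] assms N_ge by simp
  also have "\<dots> = h 1 i - h 1 j"
    using home_diff[of 2 "N + 2" 1 i j] assms N_ge by simp
  finally show ?thesis .
qed

lemma opponent_coefficients:
  obtains l u w1 w2 where
    "\<And>k j. k \<in> {1..2 * N} \<Longrightarrow> j \<noteq> t \<Longrightarrow> v k j = u k + w1 j + l * of_bool (\<not> home \<and> k \<in> {k0, k0 + N})"
    "\<And>k j. k \<in> {1..2 * N} \<Longrightarrow> j \<noteq> t \<Longrightarrow> h k j = u k + w2 j + l * of_bool (home \<and> k \<in> {k0, k0 + N})"
    "\<And>j. j \<noteq> t \<Longrightarrow> \<beta> j = l"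
proof -
  have "card (UNIV - {t}) \<noteq> 0"
    using N_ge by (simp add: card_Diff_singleton card_teams)
  then have "UNIV - {t} \<noteq> {}"
    by (metis card.empty)
  then obtain o' where o': "o' \<noteq> t"
    by blast
  \<comment> \<open>Slot parts are normalised at an arbitrary opponent \<open>o'\<close>;
    \<open>\<theta> k\<close> is the cost of being away rather than at home in slot
    \<open>k\<close>.\<close>
  define \<mu> \<nu> \<eta> \<omega> \<theta> l where "\<mu> k = v k o'" and "\<nu> j = v 1 j - v 1 o'" and "\<eta> k = h k o'" and "\<omega> j = h 1 j - h 1 o'"
    and "\<theta> k = v k o' - h k o'" and "l = \<beta> o'" for k j
  have v: "v k j = \<mu> k + \<nu> j" and h: "h k j = \<eta> k + \<omega> j" if "k \<in> {1..2 * N}" "j \<noteq> t" for k j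
    using away_diff_all[OF that o'] home_diff_all[OF that o'] by (simp_all add: \<mu>_def \<nu>_def \<eta>_def \<omega>_def)
  have \<beta>: "\<beta> j = l" if "j \<noteq> t" for j
    using leg_coeff_const[OF that o'] by (simp add: l_def)
  let ?V = "UNIV - {t}"
  define C' where "C' = C - sum \<nu> ?V - sum \<omega> ?V - sum \<eta> {1..2 * N}"
  \<comment> \<open>Opponent parts add up to a constant, as each opponent occurs once away and once
    at home. Only the dependence on the away set survives.\<close>
  have key: "sum \<theta> A + l * card (turns out A) = C'" if A: "tight A" for A
  proof -
    have AS: "A \<subseteq> {1..2 * N}" "card A = N"
      using A by (simp_all add: tight_def)
    obtain \<rho> where \<rho>: "admissible A \<rho>"
      by (rule ex_admissible[OF AS, of "{}" "\<lambda>_. t"]) auto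
    have nt: "\<rho> k \<noteq> t" if "k \<in> {1..2 * N}" for k
      using admissibleD(2)[OF \<rho> that] .
    have sub: "turns out A \<subseteq> A"
      by (auto simp: turns_def)
    have b: "bij_betw \<rho> A ?V" "bij_betw \<rho> ({1..2 * N} - A) ?V"
      using \<rho> by (simp_all add: admissible_def)
    have "(\<Sum>k\<in>A. v k (\<rho> k)) = (\<Sum>k\<in>A. \<mu> k + \<nu> (\<rho> k))"
      by (rule sum.cong[OF refl], rule v) (use AS(1) nt in blast)+
    also have "\<dots> = sum \<mu> A + sum \<nu> ?V"
      by (simp add: sum.distrib sum.reindex_bij_betw[OF b(1)])
    finally have 1: "(\<Sum>k\<in>A. v k (\<rho> k)) = sum \<mu> A + sum \<nu> ?V" .
    have "(\<Sum>k\<in>{1..2 * N} - A. h k (\<rho> k)) = (\<Sum>k\<in>{1..2 * N} - A. \<eta> k + \<omega> (\<rho> k))"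
      by (rule sum.cong[OF refl], rule h) (use nt in blast)+
    also have "\<dots> = sum \<eta> ({1..2 * N} - A) + sum \<omega> ?V"
      by (simp only: sum.distrib sum.reindex_bij_betw[OF b(2)])
    also have "sum \<eta> ({1..2 * N} - A) = sum \<eta> {1..2 * N} - sum \<eta> A"
      using AS by (intro sum_diff) auto
    finally have 2: "(\<Sum>k\<in>{1..2 * N} - A. h k (\<rho> k)) = sum \<eta> {1..2 * N} - sum \<eta> A + sum \<omega> ?V" .
    have "(\<Sum>k\<in>turns out A. \<beta> (\<rho> k)) = (\<Sum>k\<in>turns out A. l)"
      by (rule sum.cong[OF refl], rule \<beta>) (use AS(1) nt sub in blast)
    then have 3: "(\<Sum>k\<in>turns out A. \<beta> (\<rho> k)) = l * card (turns out A)"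
      by simp
    have 4: "sum \<theta> A = sum \<mu> A - sum \<eta> A"
      by (simp add: \<theta>_def \<mu>_def \<eta>_def sum_subtractf)
    show ?thesis
      using const[OF A \<rho>] unfolding 1 2 3 4 C'_def by linarith
  qed
  have block: "sum \<theta> {p..<p + N} = C' - l" if "1 \<le> p" "p \<le> N + 1" for p
    using key[OF tight_block[OF that]] that by (simp add: turns_block)
  have period: "\<theta> (p + N) = \<theta> p" if "1 \<le> p" "p \<le> N" for p
  proof -
    have "sum \<theta> {p..<p + N} = \<theta> p + sum \<theta> {Suc p..<p + N}"
      using N_ge by (simp add: sum.atLeast_Suc_lessThan)
    moreover have "sum \<theta> {Suc p..<Suc p + N} = sum \<theta> {Suc p..<p + N} + \<theta> (p + N)"
      using N_ge by simp
    ultimately show ?thesis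
      using block[of p] block[of "Suc p"] that by simp
  qed
  have K: "\<theta> (k0 + N) = \<theta> k0"
    using period k0 by simp
  have \<theta>K: "\<theta> k = \<theta> k0" if "k \<in> {k0, k0 + N}" for k
    using that K by auto
  show thesis
  proof (cases home)
    case True
    \<comment> \<open>Compared with the block starting at \<open>k0\<close>, the set with the gap
      contains \<open>k0 + N\<close> instead of \<open>q\<close> and has one more trip.\<close>
    have in_range: "\<theta> q = \<theta> k0 + l" if "k0 < q" "q < k0 + N" for q
    proof -
      have "{k0..k0 + N} = insert (k0 + N) {k0..<k0 + N}"
        by auto
      then have "sum \<theta> ({k0..k0 + N} - {q}) = \<theta> (k0 + N) + sum \<theta> {k0..<k0 + N} - \<theta> q"
        using that by (simp add: sum_diff1)
      then show ?thesis
        using key[OF tight_home(1)[OF True that]] tight_home(2)[OF True that] block[of k0] k0 K by simp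
    qed
    have \<theta>: "\<theta> k = \<theta> k0 + l" if "k \<in> {1..2 * N}" "k \<notin> {k0, k0 + N}" for k
    proof -
      consider "k < k0" | "k0 < k" "k < k0 + N" | "k0 + N < k"
        using \<open>k \<notin> {k0, k0 + N}\<close> by fastforce
      then show ?thesis
      proof cases
        case 1
        then show ?thesis
          using in_range[of "k + N"] period[of k] that k0 by auto
      next
        case 2
        then show ?thesis
          by (rule in_range)
      next
        case 3
        then show ?thesis
          using in_range[of "k - N"] period[of "k - N"] that k0 by auto
      qed
    qed
    \<comment> \<open>With the away coefficients as slot part, the deviation at \<open>k0\<close>
      and \<open>k0 + N\<close> falls on the home matches, as \<open>home\<close> demands; in the
      other case the home coefficients play this role.\<close>
    show thesis
    proof (rule that[of \<mu> \<nu> l "\<lambda>j. \<omega> j - \<theta> k0 - l"])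
      show "v k j = \<mu> k + \<nu> j + l * of_bool (\<not> home \<and> k \<in> {k0, k0 + N})" if "k \<in> {1..2 * N}" "j \<noteq> t" for k j
        using v[OF that] True by simp
      show "h k j = \<mu> k + (\<omega> j - \<theta> k0 - l) + l * of_bool (home \<and> k \<in> {k0, k0 + N})" if "k \<in> {1..2 * N}" "j \<noteq> t" for k j
      proof -
        have "h k j = \<mu> k - \<theta> k + \<omega> j"
          using h[OF that] by (simp add: \<mu>_def \<eta>_def \<theta>_def)
        then show ?thesis
          using \<theta>[OF that(1)] \<theta>K[of k] True by (cases "k \<in> {k0, k0 + N}") simp_all
      qed
    qed (fact \<beta>)
  next
    case False
    \<comment> \<open>Compared with the block starting at \<open>k0 + 1\<close>, this set contains
      \<open>q\<close> instead of \<open>k0 + N\<close> and has one more trip.\<close>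
    have out_range: "\<theta> q = \<theta> k0 - l" if q: "q \<in> {1..2 * N} - {k0..k0 + N}" for q
    proof -
      have "{Suc k0..<Suc k0 + N} = insert (k0 + N) {k0<..<k0 + N}"
        using N_ge by auto
      then have "sum \<theta> {Suc k0..<Suc k0 + N} = \<theta> (k0 + N) + sum \<theta> {k0<..<k0 + N}"
        by simp
      moreover have "sum \<theta> (insert q {k0<..<k0 + N}) = \<theta> q + sum \<theta> {k0<..<k0 + N}"
        using q by (intro sum.insert) auto
      ultimately show ?thesis
        using key[OF tight_away(1)[OF False q]] tight_away(2)[OF False q] block[of "Suc k0"] k0 K by simp
    qed
    have \<theta>: "\<theta> k = \<theta> k0 - l" if "k \<in> {1..2 * N}" "k \<notin> {k0, k0 + N}" for k
    proof -
      consider "k \<notin> {k0..k0 + N}" | "k0 < k" "k < k0 + N" "k \<le> N" | "k0 < k" "k < k0 + N" "N < k"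
        using \<open>k \<notin> {k0, k0 + N}\<close> by fastforce
      then show ?thesis
      proof cases
        case 1
        then show ?thesis
          using out_range[of k] that by auto
      next
        case 2
        then show ?thesis
          using out_range[of "k + N"] period[of k] that k0 by auto
      next
        case 3
        then show ?thesis
          using out_range[of "k - N"] period[of "k - N"] that k0 by auto
      qed
    qed
    show thesis
    proof (rule that[of \<eta> "\<lambda>j. \<nu> j + \<theta> k0 - l" l \<omega>])
      show "h k j = \<eta> k + \<omega> j + l * of_bool (home \<and> k \<in> {k0, k0 + N})" if "k \<in> {1..2 * N}" "j \<noteq> t" for k j
        using h[OF that] False by simp
      show "v k j = \<eta> k + (\<nu> j + \<theta> k0 - l) + l * of_bool (\<not> home \<and> k \<in> {k0, k0 + N})" if "k \<in> {1..2 * N}" "j \<noteq> t" for k j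
      proof -
        have "v k j = \<eta> k + \<theta> k + \<nu> j"
          using v[OF that] by (simp add: \<mu>_def \<eta>_def \<theta>_def)
        then show ?thesis
          using \<theta>[OF that(1)] \<theta>K[of k] False by (cases "k \<in> {k0, k0 + N}") simp_all
      qed
    qed (fact \<beta>)
  qed
qed

end

end

section \<open>Functionals constant on the face\<close>

text \<open>For a base vertex \<open>x\<close>, 4-cycles through \<open>x\<close> force
  \<open>D i x + D j x - D i j\<close> to be constant; half of this constant is the potential of
  \<open>x\<close>. With three vertices the cycle condition is empty and the potentials solve three
  equations.\<close>

lemma edge_potential:
  fixes D :: "'a \<Rightarrow> 'a \<Rightarrow> real"
  assumes sym: "\<And>i j. i \<in> W \<Longrightarrow> j \<in> W \<Longrightarrow> i \<noteq> j \<Longrightarrow> D i j = D j i"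
    and cycle: "\<And>i j m p. {i, j, m, p} \<subseteq> W \<Longrightarrow> distinct [i, j, m, p] \<Longrightarrow> D i j + D m p = D p i + D j m"
    and W: "3 \<le> card W"
  obtains \<alpha> where "\<And>i j. i \<in> W \<Longrightarrow> j \<in> W \<Longrightarrow> i \<noteq> j \<Longrightarrow> D i j = \<alpha> i + \<alpha> j"
proof -
  obtain Z where Z: "Z \<subseteq> W" "card Z = 3"
    by (rule obtain_subset_with_card_n[OF W])
  then obtain x y z where xyz: "Z = {x, y, z}" "distinct [x, y, z]"
    by (auto simp: card_3_iff)
  have W3: "x \<in> W" "y \<in> W" "z \<in> W" "y \<noteq> x" "z \<noteq> x" "y \<noteq> z"
    using Z(1) xyz by auto
  define E where "E i j = D i x + D j x - D i j" for i j
  have E_sym: "E i j = E j i" if "i \<in> W" "j \<in> W" "i \<noteq> j" for i j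
    using sym[OF that] by (simp add: E_def)
  have E_right: "E i j = E i m" if "i \<in> W" "j \<in> W" "m \<in> W" "i \<noteq> j" "i \<noteq> m" "i \<noteq> x" "j \<noteq> x" "m \<noteq> x" for i j m
  proof (cases "j = m")
    case False
    then have "D i j + D x m = D m i + D j x"
      using that W3 by (intro cycle) auto
    then show ?thesis
      using sym[of x m] sym[of m i] that W3 by (simp add: E_def)
  qed simp
  have E_const: "E i j = E y z" if ij: "i \<in> W" "j \<in> W" "i \<noteq> j" "i \<noteq> x" "j \<noteq> x" for i j
  proof (cases "i = z")
    case True
    then have "E i j = E z y"
      using E_right[of z j y] ij W3 by auto
    then show ?thesis
      using E_sym[of z y] W3 by simp
  next
    case False
    then have "E i j = E z i"
      using E_right[of i j z] E_sym[of i z] ij W3 by simp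
    also have "\<dots> = E z y"
      using E_right[of z i y] ij W3 False by auto
    finally show ?thesis
      using E_sym[of z y] W3 by simp
  qed
  define c where "c = E y z / 2"
  define \<alpha> where "\<alpha> i = (if i = x then c else D i x - c)" for i
  have "D i j = \<alpha> i + \<alpha> j" if ij: "i \<in> W" "j \<in> W" "i \<noteq> j" for i j
  proof -
    consider "i = x" | "j = x" | "i \<noteq> x" "j \<noteq> x"
      by blast
    then show ?thesis
    proof cases
      case 1
      then show ?thesis
        using ij sym[OF ij] by (simp add: \<alpha>_def)
    next
      case 2
      then show ?thesis
        using ij by (simp add: \<alpha>_def)
    next
      case 3
      then have "D i x + D j x - D i j = 2 * c"
        using E_const[OF ij 3] by (simp add: E_def c_def)
      then show ?thesis
        using 3 by (simp add: \<alpha>_def)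
    qed
  qed
  then show thesis
    by (rule that)
qed

context facet_setting
begin

text \<open>The exchanges act on two slots with the same opponent of \<open>t\<close>, so one must
  be an away slot and the other a home slot.\<close>

lemma separating_block:
  assumes "k \<in> {1..2 * N}" "l \<in> {1..2 * N}" "k \<noteq> l"
  obtains A where "tight A" "k \<in> A \<longleftrightarrow> l \<notin> A"
proof -
  have wlog: "\<exists>A. tight A \<and> (k \<in> A \<longleftrightarrow> l \<notin> A)" if "k \<in> {1..2 * N}" "l \<in> {1..2 * N}" "k < l" for k l
  proof -
    consider "l \<le> N" | "k \<le> N" "N < l" | "N < k"
      by linarith
    then show ?thesis
    proof cases
      case 1
      then show ?thesis
        using that by (intro exI[of _ "{k + 1..<k + 1 + N}"] conjI tight_block) auto
    next
      case 2
      then show ?thesis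
        using that by (intro exI[of _ "{1..<1 + N}"] conjI tight_block) auto
    next
      case 3
      then show ?thesis
        using that by (intro exI[of _ "{k + 1 - N..<k + 1 - N + N}"] conjI tight_block) auto
    qed
  qed
  show thesis
    using wlog[of k l] wlog[of l k] assms that by (cases "k < l") auto
qed

section \<open>Coefficients of the matches avoiding \<open>t\<close>\<close>

context
  fixes a :: "nat \<Rightarrow> 'v \<Rightarrow> 'v \<Rightarrow> real" and \<beta> :: "'v \<Rightarrow> real" and C :: real
  assumes const: "\<And>A \<rho> c d Q. tight A \<Longrightarrow> admissible A \<rho> \<Longrightarrow> orientation d \<Longrightarrow> (\<And>q. factorization t (Q q)) \<Longrightarrow>
    (\<Sum>(k, i, j)\<in>schedule A \<rho> c d Q. a k i j) + (\<Sum>k\<in>turns out A. \<beta> (\<rho> k)) = C"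
begin

lemma coeff_flip_aux:
  assumes A: "tight A" "k \<in> A" "l \<in> {1..2 * N} - A" and ij: "i \<noteq> t" "j \<noteq> t" "i \<noteq> j"
  shows "a k i j + a l j i = a k j i + a l i j"
proof -
  have AS: "A \<subseteq> {1..2 * N}" "card A = N"
    using A(1) by (simp_all add: tight_def)
  have kl: "k \<in> {1..2 * N}" "k \<noteq> l"
    using A AS by auto
  obtain Q where Q: "factorization t Q"
    using ex_factorization by blast
  obtain r where r: "r \<noteq> t" "Q r i = j"
    using factorizationD(4)[OF Q ij(3)] by blast
  obtain \<rho> where \<rho>: "admissible A \<rho>" "\<And>x. x \<in> {k, l} \<Longrightarrow> \<rho> x = r"
    by (rule ex_admissible[OF AS, of "{k, l}" "\<lambda>_. r"]) (use A kl r in \<open>auto simp: inj_on_def\<close>)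
  obtain d where d: "orientation d" "\<And>x y. x \<in> {i} \<Longrightarrow> y \<notin> {i} \<Longrightarrow> d x y"
    using ex_orientation[of "{i}"] by blast
  have dij: "d i j"
    using d(2)[of i j] ij by blast
  let ?d = "\<lambda>x y. if {x, y} = {i, j} then \<not> d x y else d x y"
  let ?T = "schedule A \<rho> (\<lambda>_. True) d (\<lambda>_. Q)" and ?T' = "schedule A \<rho> (\<lambda>_. True) ?d (\<lambda>_. Q)"
  have rr: "\<rho> k = r" "\<rho> l = r"
    using \<rho>(2) by simp_all
  note flip = schedule_flip[OF \<rho>(1) d(1) Q A(2,3) rr r ij(1,2) dij]
  let ?f = "\<lambda>(k, i, j). a k i j"
  have "sum ?f ?T - sum ?f ?T' = sum ?f {(k, i, j), (l, j, i)} - sum ?f {(k, j, i), (l, i, j)}"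
    by (rule sum_exchange[OF finite_tournament[OF tournament_schedule[OF \<rho>(1) d(1) Q]] _ flip(3,4,2)]) simp
  moreover have "sum ?f ?T = sum ?f ?T'"
    using const[OF A(1) \<rho>(1) d(1) Q, of "\<lambda>_. True"] const[OF A(1) \<rho>(1) flip(1) Q, of "\<lambda>_. True"] by linarith
  ultimately show ?thesis
    using kl by simp
qed

lemma coeff_flip:
  assumes "k \<in> {1..2 * N}" "l \<in> {1..2 * N}" "i \<noteq> t" "j \<noteq> t" "i \<noteq> j"
  shows "a k i j - a l i j = a k j i - a l j i"
proof (cases "k = l")
  case False
  obtain A where A: "tight A" "k \<in> A \<longleftrightarrow> l \<notin> A"
    using separating_block[OF assms(1,2) False] .
  show ?thesis
    using coeff_flip_aux[OF A(1), of k l i j] coeff_flip_aux[OF A(1), of l k i j] A(2) assms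
    by (cases "k \<in> A") auto
qed simp

lemma coeff_cycle_aux:
  assumes A: "tight A" "k \<in> A" "l \<in> {1..2 * N} - A" and dist: "distinct [t, i, j, m, p]"
  shows "a k i j + a k m p + a l p i + a l j m = a l i j + a l m p + a k p i + a k j m"
proof -
  have AS: "A \<subseteq> {1..2 * N}" "card A = N"
    using A(1) by (simp_all add: tight_def)
  have kl: "k \<in> {1..2 * N}" "k \<noteq> l"
    using A AS by auto
  obtain Q r where Q: "factorization t Q" and r: "r \<noteq> t" "Q r i = j" "Q r m = p"
    using ex_factorization_pairs[OF dist] by blast
  obtain \<rho> where \<rho>: "admissible A \<rho>" "\<And>x. x \<in> {k, l} \<Longrightarrow> \<rho> x = r"
    by (rule ex_admissible[OF AS, of "{k, l}" "\<lambda>_. r"]) (use A kl r in \<open>auto simp: inj_on_def\<close>)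
  obtain d where d: "orientation d" "\<And>x y. x \<in> {i, m} \<Longrightarrow> y \<notin> {i, m} \<Longrightarrow> d x y"
    using ex_orientation[of "{i, m}"] by blast
  have rr: "\<rho> k = r" "\<rho> l = r"
    using \<rho>(2) by simp_all
  let ?X = "{(k, i, j), (k, m, p), (l, p, i), (l, j, m)}" and ?Y = "{(l, i, j), (l, m, p), (k, p, i), (k, j, m)}"
  obtain Q2 c' d' where Q2: "\<And>q. factorization t (Q2 q)" and d': "orientation d'"
    and T': "schedule A \<rho> c' d' Q2 = schedule A \<rho> (\<lambda>_. True) d Q2 - ?X \<union> ?Y"
    and XY: "?X \<subseteq> schedule A \<rho> (\<lambda>_. True) d Q2" "?Y \<inter> schedule A \<rho> (\<lambda>_. True) d Q2 = {}"
    by (rule that[OF schedule_cycle[OF \<rho>(1) d(1) Q A(2,3) rr r dist d(2)]])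
  let ?f = "\<lambda>(k, i, j). a k i j"
  have "sum ?f (schedule A \<rho> (\<lambda>_. True) d Q2) - sum ?f (schedule A \<rho> c' d' Q2) = sum ?f ?X - sum ?f ?Y"
    by (rule sum_exchange[OF finite_tournament[OF tournament_schedule[OF \<rho>(1) d(1) Q2]] _ XY T']) simp
  moreover have "sum ?f (schedule A \<rho> (\<lambda>_. True) d Q2) = sum ?f (schedule A \<rho> c' d' Q2)"
    using const[where Q = Q2 and c = "\<lambda>_. True", OF A(1) \<rho>(1) d(1) Q2]
      const[where Q = Q2 and c = c', OF A(1) \<rho>(1) d' Q2] by linarith
  ultimately have "sum ?f ?X = sum ?f ?Y"
    by simp
  then show ?thesis
    using kl dist by auto
qed

lemma coeff_cycle:
  assumes "k \<in> {1..2 * N}" "l \<in> {1..2 * N}" "distinct [t, i, j, m, p]"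
  shows "(a k i j - a l i j) + (a k m p - a l m p) = (a k p i - a l p i) + (a k j m - a l j m)"
proof (cases "k = l")
  case False
  obtain A where A: "tight A" "k \<in> A \<longleftrightarrow> l \<notin> A"
    using separating_block[OF assms(1,2) False] .
  show ?thesis
    using coeff_cycle_aux[OF A(1) _ _ assms(3), of k l] coeff_cycle_aux[OF A(1) _ _ assms(3), of l k] A(2) assms
    by (cases "k \<in> A") auto
qed simp

text \<open>The exchanges give symmetry and the cycle relation only for differences between two
  slots. Hence slot 1 is the reference and \<open>a 1 i j\<close> remains as the weight of the
  ordered pair.\<close>

lemma coeff_slot_potential:
  assumes "k \<in> {1..2 * N}"
  shows "\<exists>\<alpha>. \<forall>i j. i \<noteq> t \<longrightarrow> j \<noteq> t \<longrightarrow> i \<noteq> j \<longrightarrow> a k i j = \<alpha> i + \<alpha> j + a 1 i j"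
proof -
  have 1: "1 \<in> {1..2 * N}"
    using N_ge by simp
  obtain \<alpha> where "\<And>i j. i \<in> UNIV - {t} \<Longrightarrow> j \<in> UNIV - {t} \<Longrightarrow> i \<noteq> j \<Longrightarrow> a k i j - a 1 i j = \<alpha> i + \<alpha> j"
  proof (rule edge_potential[of "UNIV - {t}" "\<lambda>i j. a k i j - a 1 i j"])
    show "3 \<le> card (UNIV - {t})"
      using N_ge by (simp add: card_Diff_singleton card_teams)
  next
    fix i j assume "i \<in> UNIV - {t}" "j \<in> UNIV - {t}" "i \<noteq> j"
    then show "a k i j - a 1 i j = a k j i - a 1 j i"
      using coeff_flip[OF assms 1, of i j] by simp
  next
    fix i j m p assume "{i, j, m, p} \<subseteq> UNIV - {t}" "distinct [i, j, m, p]"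
    then have "distinct [t, i, j, m, p]"
      by auto
    then show "a k i j - a 1 i j + (a k m p - a 1 m p) = a k p i - a 1 p i + (a k j m - a 1 j m)"
      by (rule coeff_cycle[OF assms 1])
  qed blast
  then show ?thesis
    by (intro exI[of _ \<alpha>]) (simp add: algebra_simps)
qed

lemma coefficients:
  obtains l u w where
    "\<And>k i j. k \<in> {1..2 * N} \<Longrightarrow> i \<noteq> j \<Longrightarrow>
      a k i j = u k i + u k j + w i j + l * of_bool (k \<in> {k0, k0 + N} \<and> (if home then i = t else j = t))"
    "\<And>j. j \<noteq> t \<Longrightarrow> \<beta> j = l"
proof -
  have "\<forall>k. \<exists>\<alpha>. k \<in> {1..2 * N} \<longrightarrow> (\<forall>i j. i \<noteq> t \<longrightarrow> j \<noteq> t \<longrightarrow> i \<noteq> j \<longrightarrow> a k i j = \<alpha> i + \<alpha> j + a 1 i j)"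
    using coeff_slot_potential by blast
  then obtain \<alpha> where \<alpha>: "\<And>k i j. k \<in> {1..2 * N} \<Longrightarrow> i \<noteq> t \<Longrightarrow> j \<noteq> t \<Longrightarrow> i \<noteq> j \<Longrightarrow> a k i j = \<alpha> k i + \<alpha> k j + a 1 i j"
    by (metis (no_types, lifting))
  \<comment> \<open>Everything involving \<open>t\<close> is set to 0 for now, so that the remainder
    \<open>e\<close> lives on matches of \<open>t\<close> and has constant sums by
    \<open>sum_tournament\<close>.\<close>
  define U where "U k x = (if x = t then 0 else \<alpha> k x)" for k x
  define w0 where "w0 x y = (if x = t \<or> y = t then 0 else a 1 x y)" for x y
  define e where "e k i j = a k i j - (U k i + U k j + w0 i j)" for k i j
  define K where "K = (\<Sum>k\<in>{1..2 * N}. \<Sum>i\<in>UNIV. U k i) + (\<Sum>(i, j)\<in>arcs. w0 i j)"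
  have e0: "e k i j = 0" if "k \<in> {1..2 * N}" "i \<noteq> t" "j \<noteq> t" "i \<noteq> j" for k i j
    using \<alpha>[OF that] that by (simp add: e_def U_def w0_def)
  have const': "(\<Sum>k\<in>A. e k (\<rho> k) t) + (\<Sum>k\<in>{1..2 * N} - A. e k t (\<rho> k)) + (\<Sum>k\<in>turns out A. \<beta> (\<rho> k)) = C - K"
    if A: "tight A" and \<rho>: "admissible A \<rho>" for A \<rho>
  proof -
    obtain Q where Q: "factorization t Q"
      using ex_factorization by blast
    obtain d :: "'v \<Rightarrow> 'v \<Rightarrow> bool" where d: "orientation d"
      using ex_orientation by blast
    let ?T = "schedule A \<rho> (\<lambda>_. True) d (\<lambda>_. Q)"
    let ?f = "\<lambda>(k, i, j). e k i j"
    let ?TA = "(\<lambda>k. (k, \<rho> k, t)) ` A" and ?TH = "(\<lambda>k. (k, t, \<rho> k)) ` ({1..2 * N} - A)"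
    have T: "tournament ?T"
      by (rule tournament_schedule[OF \<rho> d Q])
    have AS: "A \<subseteq> {1..2 * N}" "finite A"
      using A finite_subset[of A] by (auto simp: tight_def)
    have sub: "?TA \<union> ?TH \<subseteq> ?T"
      using schedule_home[OF \<rho> d Q] schedule_away[OF \<rho> d Q] by auto
    have rest: "?f x = 0" if "x \<in> ?T - (?TA \<union> ?TH)" for x
    proof -
      obtain k i j where x: "x = (k, i, j)"
        by (cases x)
      have "i \<noteq> t"
        using that schedule_home[OF \<rho> d Q, of k j] unfolding x by auto
      moreover have "j \<noteq> t"
        using that schedule_away[OF \<rho> d Q, of k i] unfolding x by auto
      moreover have "k \<in> {1..2 * N}" "i \<noteq> j"
        using that tournamentD[OF T, of k i j] unfolding x by auto
      ultimately show ?thesis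
        using e0 x by simp
    qed
    have "sum ?f ?T = sum ?f (?TA \<union> ?TH)"
      using sub rest by (intro sum.mono_neutral_right finite_tournament[OF T]) auto
    also have "\<dots> = sum ?f ?TA + sum ?f ?TH"
      using AS by (intro sum.union_disjoint) auto
    also have "\<dots> = (\<Sum>k\<in>A. e k (\<rho> k) t) + (\<Sum>k\<in>{1..2 * N} - A. e k t (\<rho> k))"
      by (simp add: sum.reindex inj_on_def)
    finally have 1: "sum ?f ?T = (\<Sum>k\<in>A. e k (\<rho> k) t) + (\<Sum>k\<in>{1..2 * N} - A. e k t (\<rho> k))" .
    have 2: "sum ?f ?T = (\<Sum>(k, i, j)\<in>?T. a k i j) - K"
      unfolding K_def sum_tournament[OF T, symmetric] by (simp add: e_def split_def sum_subtractf)
    show ?thesis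
      using 1 2 const[OF A \<rho> d Q, of "\<lambda>_. True"] by linarith
  qed
  show thesis
  proof (rule opponent_coefficients[where v = "\<lambda>k j. e k j t" and h = "\<lambda>k j. e k t j" and \<beta> = \<beta> and C = "C - K"])
    fix A \<rho> assume "tight A" "admissible A \<rho>"
    then show "(\<Sum>k\<in>A. e k (\<rho> k) t) + (\<Sum>k\<in>{1..2 * N} - A. e k t (\<rho> k)) + (\<Sum>k\<in>turns out A. \<beta> (\<rho> k)) = C - K"
      by (rule const')
  next
    fix l u w1 w2
    assume v: "\<And>k j. k \<in> {1..2 * N} \<Longrightarrow> j \<noteq> t \<Longrightarrow> e k j t = u k + w1 j + l * of_bool (\<not> home \<and> k \<in> {k0, k0 + N})"
      and h: "\<And>k j. k \<in> {1..2 * N} \<Longrightarrow> j \<noteq> t \<Longrightarrow> e k t j = u k + w2 j + l * of_bool (home \<and> k \<in> {k0, k0 + N})"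
      and \<beta>: "\<And>j. j \<noteq> t \<Longrightarrow> \<beta> j = l"
    show thesis
    \<comment> \<open>The slot part found for \<open>t\<close> becomes its weight in the slot
      equations, and the opponent parts become weights of the ordered pairs with
      \<open>t\<close>.\<close>
    proof (rule that[of "\<lambda>k x. if x = t then u k else \<alpha> k x" "\<lambda>i j. if i = t then w2 j else if j = t then w1 i else a 1 i j" l])
      fix k i j assume k: "k \<in> {1..2 * N}" and ij: "(i :: 'v) \<noteq> j"
      consider "i = t" "j \<noteq> t" | "j = t" "i \<noteq> t" | "i \<noteq> t" "j \<noteq> t"
        using ij by blast
      then show "a k i j = (if i = t then u k else \<alpha> k i) + (if j = t then u k else \<alpha> k j)
          + (if i = t then w2 j else if j = t then w1 i else a 1 i j)
          + l * of_bool (k \<in> {k0, k0 + N} \<and> (if home then i = t else j = t))"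
      proof cases
        case 1
        then show ?thesis
          using h[OF k 1(2)] by (auto simp: e_def U_def w0_def)
      next
        case 2
        then show ?thesis
          using v[OF k 2(2)] by (auto simp: e_def U_def w0_def)
      next
        case 3
        then show ?thesis
          using \<alpha>[OF k 3 ij] by simp
      qed
    qed (fact \<beta>)
  qed
qed

end

end

section \<open>Vertices and the facet\<close>

lemma linear_axis_sum:
  fixes f :: "real ^ 'n \<Rightarrow> real"
  assumes "linear f"
  shows "f x = (\<Sum>m\<in>UNIV. x $ m * f (axis m 1))"
proof -
  have "f x = f (\<Sum>m\<in>UNIV. (x $ m) *\<^sub>R axis m 1)"
    using basis_expansion[of x] by (simp add: scalar_mult_eq_scaleR)
  also have "\<dots> = (\<Sum>m\<in>UNIV. x $ m * f (axis m 1))"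
    using assms by (simp add: linear_sum linear_cmul)
  finally show ?thesis .
qed

context teams
begin

lemma linear_point_sum:
  fixes g :: "'v point \<Rightarrow> real"
  assumes g: "linear g" and T: "tournament T"
  shows "g (chi T, y) = (\<Sum>(k, i, j)\<in>T. g (axis (Abs_match_idx (k, i, j)) 1, 0)) + (\<Sum>q\<in>UNIV. g (0, axis q 1) * y $ q)"
proof -
  have "linear (\<lambda>x. g (x, 0))"
  proof (rule linearI)
    show "g (x + x', 0) = g (x, 0) + g (x', 0)" for x x'
      using linear_add[OF g, of "(x, 0)" "(x', 0)"] by simp
    show "g (r *\<^sub>R x, 0) = r *\<^sub>R g (x, 0)" for r x
      using linear_cmul[OF g, of r "(x, 0)"] by simp
  qed
  then have 1: "g (chi T, 0) = (\<Sum>m\<in>UNIV. chi T $ m * g (axis m 1, 0))"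
    by (rule linear_axis_sum)
  have "linear (\<lambda>y. g (0, y))"
  proof (rule linearI)
    show "g (0, x + x') = g (0, x) + g (0, x')" for x x'
      using linear_add[OF g, of "(0, x)" "(0, x')"] by simp
    show "g (0, r *\<^sub>R x) = r *\<^sub>R g (0, x)" for r x
      using linear_cmul[OF g, of r "(0, x)"] by simp
  qed
  then have 2: "g (0, y) = (\<Sum>q\<in>UNIV. y $ q * g (0, axis q 1))"
    by (rule linear_axis_sum)
  have "g (chi T, y) = g (chi T, 0) + g (0, y)"
    using linear_add[OF g, of "(chi T, 0)" "(0, y)"] by simp
  also have "\<dots> = (\<Sum>m\<in>UNIV. chi T $ m * g (axis m 1, 0)) + (\<Sum>q\<in>UNIV. y $ q * g (0, axis q 1))"
    unfolding 1 2 ..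
  finally have "g (chi T, y) = (\<Sum>m\<in>UNIV. chi T $ m * g (axis m 1, 0)) + (\<Sum>q\<in>UNIV. y $ q * g (0, axis q 1))" .
  moreover have "(\<Sum>m\<in>UNIV. chi T $ m * g (axis m 1, 0)) = (\<Sum>m\<in>T. g (axis (Abs_match_idx m) 1, 0))"
  proof -
    have "bij_betw Rep_match_idx UNIV (matches :: (nat \<times> 'v \<times> 'v) set)"
      by (rule bij_betw_byWitness[where f' = Abs_match_idx]) (auto simp: Rep_match_idx_inverse Abs_match_idx_inverse Rep_match_idx)
    from sum.reindex_bij_betw[OF this, of "\<lambda>m. indicat_real T m * g (axis (Abs_match_idx m) 1, 0)"]
    have "(\<Sum>m\<in>UNIV. chi T $ m * g (axis m 1, 0)) = (\<Sum>m\<in>matches. indicat_real T m * g (axis (Abs_match_idx m) 1, 0))"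
      by (simp add: chi_def Rep_match_idx_inverse)
    also have "\<dots> = (\<Sum>m\<in>T. indicat_real T m * g (axis (Abs_match_idx m) 1, 0))"
      using T by (intro sum.mono_neutral_right) (auto simp: tournament_def matches_def slots)
    finally show ?thesis
      by simp
  qed
  ultimately show ?thesis
    by (simp add: mult.commute split_def)
qed

section \<open>Travel vectors and trips that are not made\<close>

lemma ex_other_team: "\<exists>x. x \<noteq> i \<and> x \<noteq> (j :: 'v)"
proof -
  have "card {i, j} \<le> 2"
    by (simp add: card_insert_if)
  then have "{i, j} \<noteq> UNIV"
    using card_teams N_ge by auto
  then show ?thesis
    by blast
qed

text \<open>The largest 0/1 vector above the travel vector that agrees with it on \<^term>\<open>Z\<close>.\<close>

definition travel_vec :: "(nat \<times> 'v \<times> 'v) set \<Rightarrow> ('v \<times> 'v \<times> 'v) set \<Rightarrow> real ^ 'v travel_idx" where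
  "travel_vec T Z = (\<chi> q. of_bool (Rep_travel_idx q \<in> Z \<longrightarrow> (case Rep_travel_idx q of (s, i, j) \<Rightarrow> travels T s i j)))"

lemma travel_vec_01: "travel_vec T Z $ q \<in> {0, 1}"
  by (simp add: travel_vec_def)

lemma psi_le_travel_vec: "psi T \<le> travel_vec T Z"
  by (auto simp: less_eq_vec_def psi_def travel_vec_def split: prod.split)

lemma Rep_Abs_travel: "i \<noteq> j \<Longrightarrow> Rep_travel_idx (Abs_travel_idx (s, i, j)) = (s, i, j)"
  by (rule Abs_travel_idx_inverse) (simp add: team_arcs_def arcs_def)

text \<open>The only visit to \<open>j\<close> takes place in slot 1, so the team arrives there from
  home.\<close>

lemma not_travels_other:
  fixes T :: "(nat \<times> 'v \<times> 'v) set"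
  assumes T: "tournament T" and "(1, j, s) \<in> T" "i \<noteq> s" "j \<noteq> s"
  shows "\<not> travels T s i j"
proof
  assume "travels T s i j"
  then obtain p where "(p, i, s) \<in> T" "(Suc p, j, s) \<in> T"
    using assms(3,4) by (auto simp: travels_def at_venue_other[OF T])
  moreover from this have "Suc p = 1"
    using ex1_unique[OF unique_slot[OF T assms(4)]] assms(2) by blast
  ultimately show False
    using tournamentD[OF T, of p i s] by simp
qed

text \<open>The only visits to \<open>i\<close> and \<open>j\<close> follow each other directly, so
  the team neither returns home from \<open>i\<close> nor leaves home for \<open>j\<close>.\<close>

lemma not_travels_own:
  fixes T :: "(nat \<times> 'v \<times> 'v) set"
  assumes T: "tournament T" and m: "(1, i, s) \<in> T" "(2, j, s) \<in> T"
  shows "\<not> travels T s s j" "\<not> travels T s i s"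
proof -
  have neq: "i \<noteq> s" "j \<noteq> s"
    using tournamentD[OF T] m by auto
  have away: "1 \<in> away T s" "2 \<in> away T s"
    using m by (auto simp: away_def)
  show "\<not> travels T s s j"
  proof
    assume "travels T s s j"
    then obtain p where p: "p \<le> 2 * N" "p \<notin> away T s" "(Suc p, j, s) \<in> T"
      using neq by (auto simp: travels_def at_venue_other[OF T] at_venue_own[OF T] card_teams)
    then have "Suc p = 2"
      using ex1_unique[OF unique_slot[OF T neq(2)]] m(2) by blast
    then have "p = 1"
      by simp
    with p(2) away(1) show False
      by simp
  qed
  show "\<not> travels T s i s"
  proof
    assume "travels T s i s"
    then obtain p where p: "p \<le> 2 * N" "Suc p \<notin> away T s" "(p, i, s) \<in> T"
      using neq by (auto simp: travels_def at_venue_other[OF T] at_venue_own[OF T] card_teams)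
    then have "p = 1"
      using ex1_unique[OF unique_slot[OF T neq(1)]] m(1) by blast
    then have "Suc p = 2"
      by simp
    with p(2) away(2) show False
      by simp
  qed
qed

end

context facet_setting
begin

lemma ex_tight_two_away:
  assumes "i \<noteq> s" "j \<noteq> s" "i \<noteq> j"
  shows "\<exists>T. tournament T \<and> tight (away T t) \<and> (1, i, s) \<in> T \<and> (2, j, s) \<in> T"
proof (cases "s = t")
  case True
  let ?A = "{1..<1 + N}"
  have A: "tight ?A"
    by (rule tight_block) auto
  then have AS: "?A \<subseteq> {1..2 * N}" "card ?A = N"
    by (simp_all add: tight_def)
  obtain \<rho> where \<rho>: "admissible ?A \<rho>" "\<And>x. x \<in> {1, 2} \<Longrightarrow> \<rho> x = (if x = 1 then i else j)"
    by (rule ex_admissible[OF AS, of "{1, 2}" "\<lambda>x. if x = 1 then i else j"]) (use assms True N_ge in \<open>auto simp: inj_on_def\<close>)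
  obtain Q where Q: "factorization t Q"
    using ex_factorization by blast
  obtain d :: "'v \<Rightarrow> 'v \<Rightarrow> bool" where d: "orientation d"
    using ex_orientation by blast
  let ?T = "schedule ?A \<rho> (\<lambda>_. True) d (\<lambda>_. Q)"
  have "(1, i, t) \<in> ?T"
    by (rule schedule_away[OF \<rho>(1) d Q, THEN iffD2]) (use \<rho>(2) N_ge in simp)
  moreover have "(2, j, t) \<in> ?T"
    by (rule schedule_away[OF \<rho>(1) d Q, THEN iffD2]) (use \<rho>(2) N_ge in simp)
  moreover have "away ?T t = ?A" "tournament ?T"
    by (rule away_schedule[OF \<rho>(1) d Q], rule tournament_schedule[OF \<rho>(1) d Q])
  ultimately show ?thesis
    using A True by (intro exI[of _ ?T]) simp
next
  case False
  \<comment> \<open>With the away block of \<open>t\<close> at the end, slots 1 and 2 are home slots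
    and use the reversed orientation. As \<open>d\<close> lets \<open>s\<close> dominate,
    \<open>s\<close> is away there; a match against \<open>t\<close> fits as well, since
    \<open>t\<close> is at home.\<close>
  let ?A = "{N + 1..<N + 1 + N}"
  have A: "tight ?A"
    by (rule tight_block) auto
  then have AS: "?A \<subseteq> {1..2 * N}" "card ?A = N"
    by (simp_all add: tight_def)
  obtain Q where Q: "factorization t Q"
    using ex_factorization by blast
  obtain r1 where r1: "r1 \<noteq> t" "Q r1 i = s"
    using factorizationD(4)[OF Q assms(1)] by blast
  obtain r2 where r2: "r2 \<noteq> t" "Q r2 j = s"
    using factorizationD(4)[OF Q assms(2)] by blast
  have "r1 \<noteq> r2"
    using r1 r2 assms(3) factorizationD(2)[OF Q r1(1), of i] factorizationD(2)[OF Q r1(1), of j] by auto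
  obtain \<rho> where \<rho>: "admissible ?A \<rho>" "\<And>x. x \<in> {1, 2} \<Longrightarrow> \<rho> x = (if x = 1 then r1 else r2)"
    by (rule ex_admissible[OF AS, of "{1, 2}" "\<lambda>x. if x = 1 then r1 else r2"])
      (use \<open>r1 \<noteq> r2\<close> r1(1) r2(1) N_ge in \<open>auto simp: inj_on_def\<close>)
  have \<rho>12: "\<rho> 1 = r1" "\<rho> 2 = r2"
    using \<rho>(2) by simp_all
  obtain d where d: "orientation d" "\<And>x y. x \<in> {s} \<Longrightarrow> y \<notin> {s} \<Longrightarrow> d x y"
    using ex_orientation[of "{s}"] by blast
  let ?T = "schedule ?A \<rho> (\<lambda>_. True) d (\<lambda>_. Q)"
  have mem: "(k, x, s) \<in> ?T" if k: "k \<in> {1..2 * N} - ?A" and x: "x \<noteq> s" "Q (\<rho> k) x = s" for k x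
  proof (cases "x = t")
    case True
    have "\<rho> k \<noteq> t"
      using admissibleD(2)[OF \<rho>(1), of k] k by blast
    then have "\<rho> k = s"
      using factorizationD(1)[OF Q, of "\<rho> k"] x(2) True by simp
    then show ?thesis
      using schedule_home[OF \<rho>(1) d(1) Q] k True by blast
  next
    case xt: False
    have "\<not> d x s"
      using d(2)[of s x] orientationD[OF d(1) x(1)] x(1) by simp
    moreover have "k \<in> {1..2 * N}" "k \<notin> ?A"
      using k by blast+
    ultimately show ?thesis
      unfolding schedule_other[OF \<rho>(1) d(1) Q xt False] using x by blast
  qed
  have "(1, i, s) \<in> ?T" "(2, j, s) \<in> ?T"
    by (rule mem; use N_ge assms r1 r2 \<rho>12 in simp)+
  moreover have "away ?T t = ?A" "tournament ?T"
    by (rule away_schedule[OF \<rho>(1) d(1) Q], rule tournament_schedule[OF \<rho>(1) d(1) Q])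
  ultimately show ?thesis
    using A by (intro exI[of _ ?T]) simp
qed

lemma ex_tight_not_travels:
  assumes "i \<noteq> j"
  shows "\<exists>T. tournament T \<and> tight (away T t) \<and> \<not> travels T s i j"
proof -
  consider "i = s" | "j = s" | "i \<noteq> s" "j \<noteq> s"
    by blast
  then show ?thesis
  proof cases
    case 1
    obtain x where "x \<noteq> s" "x \<noteq> j"
      using ex_other_team by blast
    then show ?thesis
      using ex_tight_two_away[of x s j] not_travels_own(1) assms 1 by metis
  next
    case 2
    obtain x where "x \<noteq> s" "x \<noteq> i"
      using ex_other_team by blast
    then show ?thesis
      using ex_tight_two_away[of i s x] not_travels_own(2) assms 2 by metis
  next
    case 3
    then show ?thesis
      using ex_tight_two_away[of j s i] not_travels_other assms by metis
  qed
qed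

section \<open>The inequality on the vertices\<close>

definition leg :: "'v \<Rightarrow> 'v \<times> 'v \<times> 'v" where
  "leg j = (if out then (t, t, j) else (t, j, t))"

definition legs :: "('v \<times> 'v \<times> 'v) set" where
  "legs = leg ` (UNIV - {t})"

definition facet_fun :: "'v point \<Rightarrow> real" where
  "facet_fun p = (\<Sum>j\<in>UNIV - {t}. if out then yc p t t j else yc p t j t) +
     (\<Sum>j\<in>UNIV - {t}. if home then xc p k0 t j + xc p (k0 + N) t j else xc p k0 j t + xc p (k0 + N) j t)"

definition vertices :: "'v point set" where
  "vertices = {(chi T, y) |T y. tournament T \<and> (\<forall>q. y $ q \<in> {0, 1}) \<and> psi T \<le> y}"

lemma linear_xc: "linear (\<lambda>p :: 'v point. xc p k i j)"
  by (rule linearI) (simp_all add: xc_def)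

lemma linear_yc: "linear (\<lambda>p :: 'v point. yc p s i j)"
  by (rule linearI) (simp_all add: yc_def)

lemma linear_facet_fun: "linear facet_fun"
  unfolding facet_fun_def[abs_def]
  by (cases out; cases home; simp only: if_True if_False;
      intro linear_compose_add linear_compose_sum ballI linear_xc linear_yc)

lemma Rep_leg: "j \<noteq> t \<Longrightarrow> Rep_travel_idx (Abs_travel_idx (leg j)) = leg j"
  by (auto simp: leg_def Rep_Abs_travel)

lemma facet_fun_chi:
  assumes T: "tournament T"
  shows "facet_fun (chi T, y) = (\<Sum>j\<in>UNIV - {t}. y $ Abs_travel_idx (leg j)) + real (slack (away T t))"
proof -
  have S: "k0 \<in> {1..2 * N}" "k0 + N \<in> {1..2 * N}"
    using k0 by auto
  have xc: "xc (chi T, y) k i j = indicat_real T (k, i, j)" if "k \<in> {1..2 * N}" "i \<noteq> j" for k i j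
  proof -
    have "(k, i, j) \<in> (matches :: (nat \<times> 'v \<times> 'v) set)"
      using that mem_matches by blast
    then show ?thesis
      by (simp add: xc_def chi_def Abs_match_idx_inverse)
  qed
  have "(\<Sum>j\<in>UNIV - {t}. if home then xc (chi T, y) k0 t j + xc (chi T, y) (k0 + N) t j else xc (chi T, y) k0 j t + xc (chi T, y) (k0 + N) j t)
    = (\<Sum>j\<in>UNIV - {t}. if home then indicat_real T (k0, t, j) + indicat_real T (k0 + N, t, j)
        else indicat_real T (k0, j, t) + indicat_real T (k0 + N, j, t))"
    by (rule sum.cong) (use S xc in auto)
  also have "\<dots> = real (slack (away T t))"
  proof (cases home)
    case True
    then show ?thesis
      unfolding slack_def by (simp add: sum.distrib sum_home[OF T S(1)] sum_home[OF T S(2)])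
  next
    case False
    then show ?thesis
      unfolding slack_def by (simp add: sum.distrib sum_away[OF T S(1)] sum_away[OF T S(2)])
  qed
  finally show ?thesis
    unfolding facet_fun_def leg_def yc_def by (cases out) simp_all
qed

lemma sum_travels_leg:
  assumes T: "tournament T"
  shows "(\<Sum>j\<in>UNIV - {t}. of_bool (case leg j of (s, x, y) \<Rightarrow> travels T s x y)) = real (card (turns out (away T t)))"
proof -
  have "(case leg j of (s, x, y) \<Rightarrow> travels T s x y) = (if out then travels T t t j else travels T t j t)" for j
    unfolding leg_def by (cases out) simp_all
  then show ?thesis
    using sum_legs[OF T, of out t] by simp
qed

lemma facet_fun_ge: "p \<in> vertices \<Longrightarrow> 2 \<le> facet_fun p"
proof -
  assume "p \<in> vertices"
  then obtain T y where p: "p = (chi T, y)" and T: "tournament T" and y: "psi T \<le> y"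
    by (auto simp: vertices_def)
  have "of_bool (case leg j of (s, x, z) \<Rightarrow> travels T s x z) \<le> y $ Abs_travel_idx (leg j)" if "j \<in> UNIV - {t}" for j
  proof -
    have "psi T $ Abs_travel_idx (leg j) \<le> y $ Abs_travel_idx (leg j)"
      using y by (simp add: less_eq_vec_def)
    moreover have "psi T $ Abs_travel_idx (leg j) = of_bool (case leg j of (s, x, z) \<Rightarrow> travels T s x z)"
      using Rep_leg[of j] that by (simp add: psi_def split_def)
    ultimately show ?thesis
      by simp
  qed
  then have "real (card (turns out (away T t))) \<le> (\<Sum>j\<in>UNIV - {t}. y $ Abs_travel_idx (leg j))"
    unfolding sum_travels_leg[OF T, symmetric] by (rule sum_mono)
  moreover have "2 \<le> card (turns out (away T t)) + slack (away T t)"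
    by (rule turns_slack_ge[OF away_subset[OF T] card_away[OF T]])
  ultimately show ?thesis
    unfolding p facet_fun_chi[OF T] by linarith
qed

lemma travel_vec_vertex: "tournament T \<Longrightarrow> (chi T, travel_vec T Z) \<in> vertices"
  unfolding vertices_def using travel_vec_01 psi_le_travel_vec by blast

lemma travel_vec_leg:
  assumes "legs \<subseteq> Z" "j \<noteq> t"
  shows "travel_vec T Z $ Abs_travel_idx (leg j) = of_bool (case leg j of (s, x, y) \<Rightarrow> travels T s x y)"
  using assms Rep_leg[of j] by (auto simp: travel_vec_def legs_def)

lemma facet_fun_tight:
  assumes T: "tournament T" and "tight (away T t)" "legs \<subseteq> Z"
  shows "facet_fun (chi T, travel_vec T Z) = 2"
proof -
  have "(\<Sum>j\<in>UNIV - {t}. travel_vec T Z $ Abs_travel_idx (leg j)) = real (card (turns out (away T t)))"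
    unfolding sum_travels_leg[OF T, symmetric] by (rule sum.cong) (use travel_vec_leg[OF assms(3)] in auto)
  then show ?thesis
    unfolding facet_fun_chi[OF T] using assms(2) unfolding tight_def by linarith
qed

text \<open>Identifies the term with factor \<open>l\<close> in \<open>coefficients\<close> as the
  match part of the inequality.\<close>

lemma sum_slack:
  assumes T: "tournament T"
  shows "(\<Sum>(k, i, j)\<in>T. of_bool (k \<in> {k0, k0 + N} \<and> (if home then i = t else j = t))) = real (slack (away T t))"
proof -
  define F where "F k = {j. if home then (k, t, j) \<in> T else (k, j, t) \<in> T}" for k
  define e where "e k j = (if home then (k, t, j) else (k, j, t))" for k :: nat and j :: 'v
  have S: "k0 \<in> {1..2 * N}" "k0 + N \<in> {1..2 * N}"
    using k0 by auto
  have card_F: "real (card (F k)) = of_bool ((k \<in> away T t) \<noteq> home)" if "k \<in> {1..2 * N}" for k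
    using sum_home[OF T that, of t] sum_away[OF T that, of t] unfolding slot_sum_card[OF T] F_def by (cases home) auto
  have inj: "inj_on (e k) (F k)" for k
    by (auto simp: e_def inj_on_def)
  have "(\<Sum>(k, i, j)\<in>T. of_bool (k \<in> {k0, k0 + N} \<and> (if home then i = t else j = t))) =
    real (card (T \<inter> {(k, i, j). k \<in> {k0, k0 + N} \<and> (if home then i = t else j = t)}))"
    using finite_tournament[OF T] by (simp add: split_def of_bool_def sum.If_cases)
  also have "T \<inter> {(k, i, j). k \<in> {k0, k0 + N} \<and> (if home then i = t else j = t)} = e k0 ` F k0 \<union> e (k0 + N) ` F (k0 + N)"
    by (auto simp: e_def F_def image_iff)
  also have "card \<dots> = card (F k0) + card (F (k0 + N))"
  proof -
    have "card (e k0 ` F k0 \<union> e (k0 + N) ` F (k0 + N)) = card (e k0 ` F k0) + card (e (k0 + N) ` F (k0 + N))"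
      using N_ge by (intro card_Un_disjoint) (auto simp: e_def)
    then show ?thesis
      by (simp add: card_image inj)
  qed
  finally show ?thesis
    using card_F S by (simp add: slack_def)
qed

lemma tight_functional:
  assumes g: "linear g" and const: "\<And>p. p \<in> vertices \<Longrightarrow> facet_fun p = 2 \<Longrightarrow> g p = C"
  shows "\<exists>l. \<forall>p\<in>vertices. g p = C + l * (facet_fun p - 2)"
proof -
  define a where "a k i j = g (axis (Abs_match_idx (k, i, j)) 1, 0)" for k i j
  define b where "b q = g (0, axis q 1)" for q
  define \<beta> where "\<beta> j = b (Abs_travel_idx (leg j))" for j
  have g_eq: "g (chi T, y) = (\<Sum>(k, i, j)\<in>T. a k i j) + (\<Sum>q\<in>UNIV. b q * y $ q)" if "tournament T" for T y
    unfolding a_def b_def by (rule linear_point_sum[OF g that])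
  have b0: "b q = 0" if q: "Rep_travel_idx q \<notin> legs" for q
  proof -
    obtain s i j where sij: "Rep_travel_idx q = (s, i, j)"
      by (cases "Rep_travel_idx q")
    then have "i \<noteq> j"
      using Rep_travel_idx[of q] by (auto simp: team_arcs_def arcs_def)
    then obtain T where T: "tournament T" "tight (away T t)" "\<not> travels T s i j"
      using ex_tight_not_travels by blast
    \<comment> \<open>Two points of the face that differ only in coordinate \<open>q\<close>: the
      trip is not made, so the coordinate may be 1 or 0.\<close>
    let ?y = "travel_vec T legs" and ?z = "travel_vec T (insert (s, i, j) legs)"
    have "?y $ r - ?z $ r = of_bool (r = q)" for r
    proof (cases "r = q")
      case True
      then show ?thesis
        using q T(3) by (simp add: travel_vec_def sij)
    next
      case False
      then have "Rep_travel_idx r \<noteq> (s, i, j)"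
        using sij by (metis Rep_travel_idx_inject)
      then show ?thesis
        using False by (simp add: travel_vec_def)
    qed
    then have "(\<Sum>r\<in>UNIV. b r * ?y $ r) - (\<Sum>r\<in>UNIV. b r * ?z $ r) = (\<Sum>r\<in>UNIV. b r * of_bool (r = q))"
      unfolding sum_subtractf[symmetric] right_diff_distrib[symmetric] by simp
    also have "\<dots> = b q"
      by (simp add: of_bool_def if_distrib cong: if_cong)
    finally have "g (chi T, ?y) - g (chi T, ?z) = b q"
      using g_eq[OF T(1)] by simp
    moreover have "g (chi T, ?y) = C" "g (chi T, ?z) = C"
      by (rule const; use T in \<open>auto intro!: travel_vec_vertex facet_fun_tight\<close>)+
    ultimately show ?thesis
      by simp
  qed
  have b_sum: "(\<Sum>q\<in>UNIV. b q * y $ q) = (\<Sum>j\<in>UNIV - {t}. \<beta> j * y $ Abs_travel_idx (leg j))" for y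
  proof -
    have inj: "inj_on (\<lambda>j. Abs_travel_idx (leg j)) (UNIV - {t})"
    proof (rule inj_onI)
      fix i j assume ij: "i \<in> UNIV - {t}" "j \<in> UNIV - {t}" "Abs_travel_idx (leg i) = Abs_travel_idx (leg j)"
      have "Rep_travel_idx (Abs_travel_idx (leg i)) = Rep_travel_idx (Abs_travel_idx (leg j))"
        using ij(3) by (rule arg_cong)
      then have "leg i = leg j"
        using Rep_leg ij(1,2) by simp
      then show "i = j"
        by (auto simp: leg_def split: if_splits)
    qed
    have "(\<Sum>q\<in>UNIV. b q * y $ q) = (\<Sum>q\<in>(\<lambda>j. Abs_travel_idx (leg j)) ` (UNIV - {t}). b q * y $ q)"
    proof (intro sum.mono_neutral_right ballI)
      fix q assume q: "q \<in> UNIV - (\<lambda>j. Abs_travel_idx (leg j)) ` (UNIV - {t})"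
      have "Rep_travel_idx q \<notin> legs"
      proof
        assume "Rep_travel_idx q \<in> legs"
        then obtain j where "j \<in> UNIV - {t}" "Rep_travel_idx q = leg j"
          by (auto simp: legs_def)
        then have "q = Abs_travel_idx (leg j)"
          using Rep_travel_idx_inverse[of q] by simp
        then show False
          using q \<open>j \<in> UNIV - {t}\<close> by blast
      qed
      then show "b q * y $ q = 0"
        by (simp add: b0)
    qed auto
    then show ?thesis
      by (simp add: sum.reindex[OF inj] \<beta>_def)
  qed
  have sched: "(\<Sum>(k, i, j)\<in>schedule A \<rho> c d Q. a k i j) + (\<Sum>k\<in>turns out A. \<beta> (\<rho> k)) = C"
    if A: "tight A" and \<rho>: "admissible A \<rho>" and d: "orientation d" and Q: "\<And>q. factorization t (Q q)" for A \<rho> c d Q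
  proof -
    let ?T = "schedule A \<rho> c d Q"
    have T: "tournament ?T"
      by (rule tournament_schedule[OF \<rho> d Q])
    have away: "away ?T t = A"
      by (rule away_schedule[OF \<rho> d Q])
    have "(\<Sum>j\<in>UNIV - {t}. \<beta> j * travel_vec ?T legs $ Abs_travel_idx (leg j)) =
        (\<Sum>j\<in>UNIV - {t}. if j \<in> \<rho> ` turns out A then \<beta> j else 0)"
    proof (rule sum.cong[OF refl])
      fix j assume "j \<in> UNIV - {t}"
      then have j: "j \<noteq> t"
        by simp
      have "(case leg j of (s, x, y) \<Rightarrow> travels ?T s x y) = (if out then travels ?T t t j else travels ?T t j t)"
        unfolding leg_def by (cases out) simp_all
      also have "\<dots> \<longleftrightarrow> (\<exists>k\<in>turns out A. (k, j, t) \<in> ?T)"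
        using travels_leg[OF T j, of out] by (simp add: away)
      also have "\<dots> \<longleftrightarrow> j \<in> \<rho> ` turns out A"
        unfolding schedule_away[OF \<rho> d Q] by (auto simp: turns_def)
      finally show "\<beta> j * travel_vec ?T legs $ Abs_travel_idx (leg j) = (if j \<in> \<rho> ` turns out A then \<beta> j else 0)"
        by (simp add: travel_vec_leg[OF subset_refl j])
    qed
    also have "\<dots> = sum \<beta> (\<rho> ` turns out A)"
    proof -
      have "\<rho> k \<noteq> t" if "k \<in> turns out A" for k
      proof -
        have "k \<in> A"
          using that by (simp add: turns_def)
        then show ?thesis
          using admissibleD(1,2)[OF \<rho>] by blast
      qed
      then have "(UNIV - {t}) \<inter> \<rho> ` turns out A = \<rho> ` turns out A"
        by auto
      then show ?thesis
        by (simp add: sum.inter_restrict[symmetric])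
    qed
    also have "\<dots> = (\<Sum>k\<in>turns out A. \<beta> (\<rho> k))"
    proof -
      have "inj_on \<rho> A"
        using \<rho> by (simp add: admissible_def bij_betw_def)
      then have "inj_on \<rho> (turns out A)"
        by (rule inj_on_subset) (auto simp: turns_def)
      then show ?thesis
        by (simp add: sum.reindex)
    qed
    finally have "g (chi ?T, travel_vec ?T legs) = (\<Sum>(k, i, j)\<in>?T. a k i j) + (\<Sum>k\<in>turns out A. \<beta> (\<rho> k))"
      unfolding g_eq[OF T] b_sum by simp
    moreover have "g (chi ?T, travel_vec ?T legs) = C"
      by (rule const[OF travel_vec_vertex[OF T] facet_fun_tight[OF T]]) (use A away in auto)
    ultimately show ?thesis
      by simp
  qed
  show ?thesis
  proof (rule coefficients[OF sched])
    fix l u w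
    assume a: "\<And>k i j. k \<in> {1..2 * N} \<Longrightarrow> i \<noteq> j \<Longrightarrow>
        a k i j = u k i + u k j + w i j + l * of_bool (k \<in> {k0, k0 + N} \<and> (if home then i = t else j = t))"
      and \<beta>: "\<And>j. j \<noteq> t \<Longrightarrow> \<beta> j = l"
    define K where "K = (\<Sum>k\<in>{1..2 * N}. \<Sum>i\<in>UNIV. u k i) + (\<Sum>(i, j)\<in>arcs. w i j)"
    have g_facet: "g p = K + l * facet_fun p" if "p \<in> vertices" for p
    proof -
      obtain T y where p: "p = (chi T, y)" and T: "tournament T"
        using \<open>p \<in> vertices\<close> by (auto simp: vertices_def)
      have "(\<Sum>(k, i, j)\<in>T. a k i j) = (\<Sum>(k, i, j)\<in>T. (u k i + u k j + w i j) + l * of_bool (k \<in> {k0, k0 + N} \<and> (if home then i = t else j = t)))"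
      proof (rule sum.cong[OF refl])
        fix m assume m: "m \<in> T"
        obtain k i j where "m = (k, i, j)"
          by (cases m)
        then show "(case m of (k, i, j) \<Rightarrow> a k i j) = (case m of (k, i, j) \<Rightarrow> (u k i + u k j + w i j) + l * of_bool (k \<in> {k0, k0 + N} \<and> (if home then i = t else j = t)))"
          using a[of k i j] tournamentD[OF T, of k i j] m by simp
      qed
      also have "\<dots> = (\<Sum>(k, i, j)\<in>T. u k i + u k j + w i j) + l * (\<Sum>(k, i, j)\<in>T. of_bool (k \<in> {k0, k0 + N} \<and> (if home then i = t else j = t)))"
        by (simp add: split_def sum.distrib sum_distrib_left)
      also have "\<dots> = K + l * real (slack (away T t))"
        unfolding K_def sum_slack[OF T] sum_tournament[OF T] ..
      finally have 1: "(\<Sum>(k, i, j)\<in>T. a k i j) = K + l * real (slack (away T t))" .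
      have 2: "(\<Sum>j\<in>UNIV - {t}. \<beta> j * y $ Abs_travel_idx (leg j)) = l * (\<Sum>j\<in>UNIV - {t}. y $ Abs_travel_idx (leg j))"
        unfolding sum_distrib_left by (rule sum.cong) (use \<beta> in auto)
      show ?thesis
        unfolding p g_eq[OF T] b_sum 1 2 facet_fun_chi[OF T] by (simp add: algebra_simps)
    qed
    obtain x where x: "x \<noteq> t"
      using ex_other_team by blast
    obtain T where T: "tournament T" "tight (away T t)"
      using ex_tight_not_travels[OF x] by blast
    have "K + l * 2 = C"
      using g_facet[OF travel_vec_vertex[OF T(1), of legs]] const[OF travel_vec_vertex[OF T(1), of legs]]
        facet_fun_tight[OF T subset_refl] by simp
    then show ?thesis
      using g_facet by (intro exI[of _ l]) (auto simp: algebra_simps)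
  qed
qed

lemma facet_defining_facet_fun: "facet_defining facet_fun 2 P_utt"
proof -
  obtain x where x: "x \<noteq> t"
    using ex_other_team by blast
  obtain T where T: "tournament T" "tight (away T t)"
    using ex_tight_not_travels[OF x] by blast
  have eq: "facet_fun (chi T, travel_vec T legs) = 2"
    by (rule facet_fun_tight[OF T subset_refl])
  \<comment> \<open>A point off the face: with all travel coordinates equal to 1, the trip terms
    alone give \<open>N \<ge> 3\<close>.\<close>
  have "facet_fun (chi T, travel_vec T {}) = N + slack (away T t)"
    unfolding facet_fun_chi[OF T(1)] by (simp add: travel_vec_def card_Diff_singleton card_teams)
  then have gt: "2 < facet_fun (chi T, travel_vec T {})"
    using N_ge by linarith
  have "P_utt = convex hull vertices"
    by (simp add: P_utt_def vertices_def)
  moreover have "facet_defining facet_fun 2 (convex hull vertices)"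
    by (rule facet_criterion[OF linear_facet_fun facet_fun_ge travel_vec_vertex[OF T(1)] eq travel_vec_vertex[OF T(1)] gt])
      (assumption, rule tight_functional)
  ultimately show ?thesis
    by simp
qed

end

theorem theorem15:
  fixes t :: "'v::card2" and n k :: nat
  assumes "n = CARD('v)" and "n \<ge> 4" and "even n" and "k \<in> {1..n - 1}"
  shows "facet_defining
           (\<lambda>p. (\<Sum>j\<in>UNIV - {t}. yc p t t j)
              + (\<Sum>j\<in>UNIV - {t}. (xc p k t j + xc p (k + n - 1) t j))) 2 P_utt \<and>
         facet_defining
           (\<lambda>p. (\<Sum>j\<in>UNIV - {t}. yc p t t j)
              + (\<Sum>j\<in>UNIV - {t}. (xc p k j t + xc p (k + n - 1) j t))) 2 P_utt \<and>
         facet_defining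
           (\<lambda>p. (\<Sum>i\<in>UNIV - {t}. yc p t i t)
              + (\<Sum>i\<in>UNIV - {t}. (xc p k t i + xc p (k + n - 1) t i))) 2 P_utt \<and>
         facet_defining
           (\<lambda>p. (\<Sum>i\<in>UNIV - {t}. yc p t i t)
              + (\<Sum>i\<in>UNIV - {t}. (xc p k i t + xc p (k + n - 1) i t))) 2 P_utt"
proof -
  have facet: "facet_defining (\<lambda>p. (\<Sum>j\<in>UNIV - {t}. if out then yc p t t j else yc p t j t) +
      (\<Sum>j\<in>UNIV - {t}. if home then xc p k t j + xc p (k + (n - 1)) t j
        else xc p k j t + xc p (k + (n - 1)) j t)) 2 P_utt" for out home
  proof -
    interpret facet_setting t "n - 1" out home k
      by unfold_locales (use assms in auto)
    show ?thesis
      using facet_defining_facet_fun unfolding facet_fun_def[abs_def] .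
  qed
  have "k + n - 1 = k + (n - 1)"
    using assms(2) by simp
  then show ?thesis
    using facet[of True True] facet[of True False] facet[of False True] facet[of False False] by simp
qed

end
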